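(* Let $d\in\mathbb{N}$ and let $\mu$ be an arbitrary probability measure on $\mathbb{R}^d$. For any $R>0$, any $f\in\mathcal{F}_R$ (that is, $f:\mathbb{R}^d\to\mathbb{R}$ continuous and Lebesgue-integrable with $L^1[\widehat f]:=\int_{\mathbb{R}^d}|\widehat f(\boldsymbol\xi)|\,d\boldsymbol\xi\le R$) and any $n\in\mathbb{N}$, there exists $\boldsymbol\theta\in\boldsymbol\Theta=(\mathbb{R}^d\times\mathbb{R}\times[0,2\pi])^n$ such that the quantum neural network $f^R_{n,\boldsymbol\theta}$ (defined in the context) satisfies $$\left(\int_{\mathbb{R}^d}\left|f(\boldsymbol x)-f^R_{n,\boldsymbol\theta}(\boldsymbol x)\right|^2\mu(d\boldsymbol x)\right)^{1/2}\le\frac{L^1[\widehat f]}{\sqrt n}.$$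
   Context: Fourier transform: $\widehat f(\boldsymbol\xi)=\int_{\mathbb{R}^d}e^{-2\pi \mathrm{i}\,\boldsymbol y\cdot\boldsymbol\xi}f(\boldsymbol y)\,d\boldsymbol y$. Quantum circuit. Let $n\in\mathbb{N}$, $\boldsymbol\theta=(\boldsymbol a^i,b^i,\gamma^i)_{i=1,\dots,n}\in\boldsymbol\Theta=(\mathbb{R}^d\times\mathbb{R}\times[0,2\pi])^n$, $\boldsymbol x\in\mathbb{R}^d$. Let $\mathtt H=\frac1{\sqrt2}\begin{pmatrix}1&1\\1&-1\end{pmatrix}$, $\mathtt R_y(\gamma)=\begin{pmatrix}\cos(\gamma/2)&-\sin(\gamma/2)\\ \sin(\gamma/2)&\cos(\gamma/2)\end{pmatrix}$, $\mathtt R_z(\alpha)=\begin{pmatrix}e^{-\mathrm i\alpha/2}&0\\0&e^{\mathrm i\alpha/2}\end{pmatrix}$. For $i=1,\dots,n$ put $\mathtt U_1^{(i)}=\mathtt H\,\mathtt R_z(-b^i)\,\mathtt R_z(-a^i_dx_d)\cdots\mathtt R_z(-a^i_1x_1)\,\mathtt H$, $\mathtt U_2^{(i)}=\mathtt R_y(\gamma^i)$, and $\bar{\mathtt U}^{(i)}=\mathtt U_1^{(i)}\otimes\mathtt U_2^{(i)}\in\mathbb{C}^{4\times4}$ (Kronecker product). Let $n_0\ge0$ be the smallest integer with $\log_2(4n+n_0)\in\mathbb{N}$, $\mathfrak n=\lceil\log_2(4n)\rceil$, $N=4n+n_0=2^{\mathfrak n}$, and let $\mathtt U(\boldsymbol\theta,\boldsymbol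 x)\in\mathbb{C}^{N\times N}$ be the block-diagonal unitary matrix with diagonal blocks $\bar{\mathtt U}^{(1)},\dots,\bar{\mathtt U}^{(n)}$ and the $n_0\times n_0$ identity. Denote by $|0\rangle,\dots,|N-1\rangle$ the computational (standard) basis of $\mathbb{C}^N$, with $|0\rangle=|0\rangle^{\otimes\mathfrak n}$, and let $\mathtt V\in\mathbb{C}^{N\times N}$ be any unitary matrix mapping $|0\rangle^{\otimes\mathfrak n}$ to $|\psi\rangle=\frac1{\sqrt n}\sum_{i=0}^{n-1}|4i\rangle$. The circuit is $\mathtt C_{\mathfrak n}(\boldsymbol\theta,\boldsymbol x)=\mathtt U(\boldsymbol\theta,\boldsymbol x)\mathtt V$. For $m\in\{0,1,2,3\}$, $\mathbb{P}^n_m(\boldsymbol\theta,\boldsymbol x)$ is the probability that measuring $\mathtt C_{\mathfrak n}(\boldsymbol\theta,\boldsymbol x)|0\rangle^{\otimes\mathfrak n}$ in the computational basis gives an outcome in $\{m,4+m,\dots,4(n-1)+m\}$, i.e. $\mathbb{P}^n_m=\sum_{i=0}^{n-1}|\langle 4i+m|\mathtt U\mathtt V|0\rangle^{\otimes\mathfrak n}|^2$. For $R>0$, the quantum neural network is $$f^R_{n,\boldsymbol\theta}(\boldsymbol x)=R-2R\left[\mathbb{P}^n_1(\boldsymbol\theta,\boldsymbol x)+\mathbb{P}^n_2(\boldsymbol\theta,\boldsymbol x)\right].$$ *)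

theory Defs
  imports
    "HOL-Analysis.Analysis"
    "HOL-Probability.Probability"
    "Jordan_Normal_Form.Matrix"
    "Jordan_Normal_Form.Schur_Decomposition"
begin

text \<open>
  Points of \<open>\<real>\<^sup>d\<close> have type \<open>real ^ 'd\<close> with \<open>d = CARD('d)\<close>. Where the circuit needs the
  coordinates in their order \<open>1, \<dots>, d\<close>, the index type is linearly ordered.
  Circuit matrices, whose size depends on \<open>n\<close>, are Jordan-Normal-Form matrices over \<open>complex\<close>,
  indexed from 0. The infix \<open>$\<close> is ambiguous between the two vector types; types resolve it.
\<close>

section \<open>Fourier transform and the function class\<close>

definition fourier :: "(real ^ 'd \<Rightarrow> real) \<Rightarrow> real ^ 'd \<Rightarrow> complex" where
  "fourier f \<xi> =
     (LINT y|lborel. exp (- 2 * complex_of_real pi * \<i> * complex_of_real (inner y \<xi>)) * complex_of_real (f y))"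

definition L1_norm :: "(real ^ 'd \<Rightarrow> complex) \<Rightarrow> real" where
  "L1_norm g = (LINT \<xi>|lborel. cmod (g \<xi>))"

text \<open>
  Integrability of the Fourier transform is explicit because the Bochner integral of a
  non-integrable function is 0 by convention.
\<close>

definition F_class :: "real \<Rightarrow> (real ^ 'd \<Rightarrow> real) set" where
  "F_class R = {f. continuous_on UNIV f \<and> integrable lborel f \<and>
                   integrable lborel (fourier f) \<and> L1_norm (fourier f) \<le> R}"

section \<open>Parameters\<close>

text \<open>An \<open>n\<close>-tuple is an extensional function on \<open>{1..n}\<close>.\<close>

type_synonym 'd params = "nat \<Rightarrow> (real ^ 'd) \<times> real \<times> real"

definition Theta :: "nat \<Rightarrow> 'd params set" where
  "Theta n = (\<Pi>\<^sub>E i\<in>{1..n}. UNIV \<times> UNIV \<times> {0..2 * pi})"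

section \<open>Gates\<close>

definition H_gate :: "complex mat" where
  "H_gate = complex_of_real (1 / sqrt 2) \<cdot>\<^sub>m mat_of_rows_list 2 [[1, 1], [1, -1]]"

definition Ry_gate :: "real \<Rightarrow> complex mat" where
  "Ry_gate \<gamma> = mat_of_rows_list 2
     [[complex_of_real (cos (\<gamma> / 2)), complex_of_real (- sin (\<gamma> / 2))],
      [complex_of_real (sin (\<gamma> / 2)), complex_of_real (cos (\<gamma> / 2))]]"

definition Rz_gate :: "real \<Rightarrow> complex mat" where
  "Rz_gate \<alpha> = mat_of_rows_list 2
     [[exp (- \<i> * complex_of_real \<alpha> / 2), 0],
      [0, exp (\<i> * complex_of_real \<alpha> / 2)]]"

definition kronecker :: "complex mat \<Rightarrow> complex mat \<Rightarrow> complex mat" where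
  "kronecker A B = mat (dim_row A * dim_row B) (dim_col A * dim_col B)
     (\<lambda>(i, j). A $$ (i div dim_row B, j div dim_col B) * B $$ (i mod dim_row B, j mod dim_col B))"

text \<open>The product has the factor of the largest coordinate leftmost.\<close>

definition Rz_product :: "real ^ 'd::{finite,linorder} \<Rightarrow> real ^ 'd::{finite,linorder} \<Rightarrow> complex mat" where
  "Rz_product a x =
     foldr (*) (map (\<lambda>k. Rz_gate (- (a $ k * x $ k))) (rev (sorted_list_of_set UNIV))) (1\<^sub>m 2)"

definition U1 :: "real ^ 'd::{finite,linorder} \<Rightarrow> real \<Rightarrow> real ^ 'd::{finite,linorder} \<Rightarrow> complex mat" where
  "U1 a b x = H_gate * Rz_gate (- b) * Rz_product a x * H_gate"

definition U2 :: "real \<Rightarrow> complex mat" where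
  "U2 \<gamma> = Ry_gate \<gamma>"

definition U_bar :: "('d::{finite,linorder}) params \<Rightarrow> nat \<Rightarrow> real ^ 'd::{finite,linorder} \<Rightarrow> complex mat" where
  "U_bar \<theta> i x = (case \<theta> i of (a, b, \<gamma>) \<Rightarrow> kronecker (U1 a b x) (U2 \<gamma>))"

section \<open>The circuit\<close>

definition n_pad :: "nat \<Rightarrow> nat" where
  "n_pad n = (LEAST k. log 2 (real (4 * n + k)) \<in> \<nat>)"

definition num_qubits :: "nat \<Rightarrow> nat" where
  "num_qubits n = nat \<lceil>log 2 (real (4 * n))\<rceil>"

definition circuit_dim :: "nat \<Rightarrow> nat" where
  "circuit_dim n = 4 * n + n_pad n"

lemma circuit_dim_eq:
  assumes "n > 0"
  shows "circuit_dim n = 2 ^ num_qubits n"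
proof -
  let ?P = "\<lambda>k. log 2 (real (4 * n + k)) \<in> \<nat>"
  let ?q = "num_qubits n"
  have pow: "\<exists>m::nat. 4 * n + k = 2 ^ m \<and> ?q \<le> m" if k: "?P k" for k
  proof -
    obtain m :: nat where m: "log 2 (real (4 * n + k)) = real m"
      using k by (rule Nats_cases)
    have "real (4 * n + k) = 2 powr real m"
      using assms m powr_log_cancel[of 2 "real (4 * n + k)"] by simp
    hence 1: "4 * n + k = 2 ^ m"
      using of_nat_eq_iff[of "4 * n + k" "2 ^ m", where 'a = real] by (simp add: powr_realpow)
    have "log 2 (real (4 * n)) \<le> log 2 (real (4 * n + k))"
      using assms by (subst log_le_cancel_iff) auto
    hence "?q \<le> m"
      using m unfolding num_qubits_def by (simp add: ceiling_le_iff nat_le_iff)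
    with 1 show ?thesis by blast
  qed
  have "log 2 (real (4 * n)) \<le> real ?q"
    unfolding num_qubits_def by linarith
  hence "real (4 * n) \<le> 2 powr real ?q"
    using assms by (subst (asm) log_le_iff) auto
  hence "4 * n \<le> 2 ^ ?q"
    using of_nat_le_iff[of "4 * n" "2 ^ ?q", where 'a = real] by (simp add: powr_realpow)
  then obtain k0 where k0: "2 ^ ?q = 4 * n + k0"
    using le_Suc_ex by blast
  have "log 2 (real (2 ^ ?q)) = real ?q" by (simp add: log_nat_power)
  hence P0: "?P k0" using k0 by (metis of_nat_in_Nats)
  have "(LEAST k. ?P k) = k0"
  proof (rule Least_equality)
    show "?P k0" by (rule P0)
  next
    fix k assume "?P k"
    then obtain m where "4 * n + k = 2 ^ m" "?q \<le> m" using pow by blast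
    then have "4 * n + k0 \<le> 4 * n + k"
      using k0 by (metis one_le_numeral power_increasing)
    thus "k0 \<le> k" by simp
  qed
  thus ?thesis unfolding circuit_dim_def n_pad_def using k0 by simp
qed

definition U_mat :: "nat \<Rightarrow> ('d::{finite,linorder}) params \<Rightarrow> real ^ 'd::{finite,linorder} \<Rightarrow> complex mat" where
  "U_mat n \<theta> x = diag_block_mat (map (\<lambda>i. U_bar \<theta> i x) [1..<n + 1] @ [1\<^sub>m (n_pad n)])"

text \<open>
  The computational basis vector \<open>|k\<rangle>\<close> of \<open>\<complex>\<^sup>N\<close>; for \<open>k = 0\<close> this is the tensor power of the
  one-qubit vector \<open>|0\<rangle>\<close>.
\<close>

definition ket :: "nat \<Rightarrow> nat \<Rightarrow> complex vec" where
  "ket n k = unit_vec (circuit_dim n) k"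

definition psi :: "nat \<Rightarrow> complex vec" where
  "psi n = complex_of_real (1 / sqrt (real n)) \<cdot>\<^sub>v
     finsum_vec TYPE(complex) (circuit_dim n) (\<lambda>i. ket n (4 * i)) {0..<n}"

definition unitary_mat :: "nat \<Rightarrow> complex mat \<Rightarrow> bool" where
  "unitary_mat N V \<longleftrightarrow> V \<in> carrier_mat N N \<and>
     mat_adjoint V * V = 1\<^sub>m N \<and> V * mat_adjoint V = 1\<^sub>m N"

definition state_prep :: "nat \<Rightarrow> complex mat \<Rightarrow> bool" where
  "state_prep n V \<longleftrightarrow> unitary_mat (circuit_dim n) V \<and> V *\<^sub>v ket n 0 = psi n"

definition circuit :: "nat \<Rightarrow> complex mat \<Rightarrow> ('d::{finite,linorder}) params \<Rightarrow> real ^ 'd::{finite,linorder} \<Rightarrow> complex mat" where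
  "circuit n V \<theta> x = U_mat n \<theta> x * V"

text \<open>\<open>v \<bullet>c w\<close> conjugates \<open>w\<close>, so the summand is \<open>|\<langle>4i+m|C|0\<rangle>|\<^sup>2\<close>.\<close>

definition outcome_prob ::
    "nat \<Rightarrow> complex mat \<Rightarrow> nat \<Rightarrow> ('d::{finite,linorder}) params \<Rightarrow> real ^ 'd::{finite,linorder} \<Rightarrow> real" where
  "outcome_prob n V m \<theta> x =
     (\<Sum>i = 0..<n. (cmod ((circuit n V \<theta> x *\<^sub>v ket n 0) \<bullet>c ket n (4 * i + m)))\<^sup>2)"

definition qnn :: "real \<Rightarrow> nat \<Rightarrow> complex mat \<Rightarrow> ('d::{finite,linorder}) params \<Rightarrow> real ^ 'd::{finite,linorder} \<Rightarrow> real" where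
  "qnn R n V \<theta> x = R - 2 * R * (outcome_prob n V 1 \<theta> x + outcome_prob n V 2 \<theta> x)"

end

theory Submission
  imports Defs
begin

text \<open>
  Only the first column of each \<open>4 \<times> 4\<close> block acts on the prepared state, and it turns the circuit into
  the cosine network \<open>R / n * (\<Sum>i. cos \<gamma>\<^sub>i * cos (b\<^sub>i + a\<^sub>i \<bullet> x))\<close>. Fourier inversion, obtained by Gaussian
  regularisation, writes \<open>f\<close> as the mean of \<open>L * cos (2 \<pi> x \<bullet> \<xi> + arg (fourier f \<xi>))\<close> for \<open>\<xi>\<close> with density
  \<open>\<bar>fourier f\<bar> / L\<close>, where \<open>L\<close> is the \<open>L\<^sup>1\<close> norm of the transform; each such function is one neuron because
  \<open>L \<le> R\<close> makes \<open>\<gamma> = arccos (L / R)\<close> available. Choosing the neurons one after another, each no worse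
  than the average, keeps the squared error of \<open>k\<close> summed deviations below \<open>k * L\<^sup>2\<close>.
\<close>

section \<open>The circuit as a cosine network\<close>

text \<open>Induction on the list of blocks: peeling off the first one lowers both block indices by
  one and shifts both positions by \<open>q\<close>. The tail \<open>Bs\<close> may have any size,
  which leaves room for the identity padding of the circuit.\<close>

lemma diag_block_mat_index_blocks:
  fixes As Bs :: "'a::zero mat list"
  assumes "\<And>A. A \<in> set As \<Longrightarrow> A \<in> carrier_mat q q" "i < length As" "j < length As" "m < q" "l < q"
  shows "diag_block_mat (As @ Bs) $$ (q * i + m, q * j + l) = (if i = j then (As ! i) $$ (m, l) else 0)"
  using assms
proof (induction As arbitrary: i j)
  case (Cons A As)
  let ?D = "diag_block_mat (As @ Bs)"
  have A: "dim_row A = q" "dim_col A = q" using Cons.prems(1)[of A] by auto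
  have car: "X \<in> carrier_mat q q" if "X \<in> set As" for X using Cons.prems(1)[of X] that by auto
  have As: "map dim_row As = replicate (length As) q" "map dim_col As = replicate (length As) q"
    using car by (auto simp: map_replicate_const[symmetric])
  have "dim_row ?D \<ge> q * length As" "dim_col ?D \<ge> q * length As"
    by (auto simp: dim_diag_block_mat As sum_list_replicate)
  moreover have bd: "q * a + r < q + q * length As" if "a < Suc (length As)" "r < q" for a r
  proof -
    have "q * a \<le> q * length As" using that by simp
    thus ?thesis using that by linarith
  qed
  ultimately have lt: "q * i + m < q + dim_row ?D" "q * j + l < q + dim_col ?D"
    using less_le_trans[OF bd[of i m]] less_le_trans[OF bd[of j l]] Cons.prems(2-5) by simp_all
  \<comment> \<open>One step of \<open>diag_block_mat\<close> is a four-block matrix with zero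
    off-diagonal blocks. Its entry formula holds only within the dimensions, which is what
    \<open>lt\<close> secures.\<close>
  have entry: "diag_block_mat ((A # As) @ Bs) $$ (q * i + m, q * j + l) =
      (if q * i + m < q then if q * j + l < q then A $$ (q * i + m, q * j + l)
         else 0\<^sub>m q (dim_col ?D) $$ (q * i + m, q * j + l - q)
       else if q * j + l < q then 0\<^sub>m (dim_row ?D) q $$ (q * i + m - q, q * j + l)
         else ?D $$ (q * i + m - q, q * j + l - q))"
    using lt by (simp add: Let_def A)
  show ?case
  proof (cases i)
    case i: 0
    show ?thesis
    proof (cases j)
      case 0
      thus ?thesis unfolding entry using i Cons.prems(4,5) by simp
    next
      case (Suc j')
      hence "\<not> q * j + l < q" "q * j + l - q = q * j' + l" by simp_all
      thus ?thesis unfolding entry using i Suc lt(2) Cons.prems(4,5) by simp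
    qed
  next
    case i: (Suc i')
    hence i': "\<not> q * i + m < q" "q * i + m - q = q * i' + m" by simp_all
    show ?thesis
    proof (cases j)
      case 0
      thus ?thesis unfolding entry using i i' lt(1) Cons.prems(4,5) by simp
    next
      case (Suc j')
      hence "\<not> q * j + l < q" "q * j + l - q = q * j' + l" by simp_all
      moreover have "?D $$ (q * i' + m, q * j' + l) = (if i' = j' then (As ! i') $$ (m, l) else 0)"
        using Cons.IH[OF car, of i' j'] Cons.prems(2-5) i Suc by simp
      ultimately show ?thesis unfolding entry using i i' Suc by simp
    qed
  qed
qed simp

section \<open>Products of one-qubit gates\<close>

lemma eq_mat_2I:
  assumes "A \<in> carrier_mat 2 2" "B \<in> carrier_mat 2 2"
    and "A $$ (0, 0) = B $$ (0, 0)" "A $$ (0, 1) = B $$ (0, 1)"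
    and "A $$ (1, 0) = B $$ (1, 0)" "A $$ (1, 1) = B $$ (1, 1)"
  shows "A = B"
  using assms by (intro eq_matI) (auto simp: less_2_cases_iff)

lemma mult_mat_2_index:
  fixes A B :: "complex mat"
  assumes "A \<in> carrier_mat 2 2" "B \<in> carrier_mat 2 2" "i < 2" "j < 2"
  shows "(A * B) $$ (i, j) = A $$ (i, 0) * B $$ (0, j) + A $$ (i, 1) * B $$ (1, j)"
  using assms by (simp add: scalar_prod_def numeral_2_eq_2)

lemma H_gate_index:
  "H_gate \<in> carrier_mat 2 2"
  "H_gate $$ (0, 0) = complex_of_real (1 / sqrt 2)" "H_gate $$ (0, 1) = complex_of_real (1 / sqrt 2)"
  "H_gate $$ (1, 0) = complex_of_real (1 / sqrt 2)" "H_gate $$ (1, 1) = - complex_of_real (1 / sqrt 2)"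
  by (auto simp: H_gate_def mat_of_rows_list_def intro: carrier_matI)

lemma Rz_gate_index:
  "Rz_gate \<alpha> \<in> carrier_mat 2 2"
  "Rz_gate \<alpha> $$ (0, 0) = exp (- \<i> * complex_of_real \<alpha> / 2)" "Rz_gate \<alpha> $$ (0, 1) = 0"
  "Rz_gate \<alpha> $$ (1, 0) = 0" "Rz_gate \<alpha> $$ (1, 1) = exp (\<i> * complex_of_real \<alpha> / 2)"
  by (auto simp: Rz_gate_def mat_of_rows_list_def intro: carrier_matI)

lemma Rz_gate_mult: "Rz_gate \<alpha> * Rz_gate \<beta> = Rz_gate (\<alpha> + \<beta>)"
proof -
  have idx: "(0::nat) < 2" "(1::nat) < 2" by auto
  have c: "Rz_gate \<alpha> * Rz_gate \<beta> \<in> carrier_mat 2 2"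
    by (rule mult_carrier_mat[OF Rz_gate_index(1) Rz_gate_index(1)])
  have "exp (- \<i> * complex_of_real \<alpha> / 2) * exp (- \<i> * complex_of_real \<beta> / 2)
      = exp (- \<i> * complex_of_real (\<alpha> + \<beta>) / 2)"
    "exp (\<i> * complex_of_real \<alpha> / 2) * exp (\<i> * complex_of_real \<beta> / 2)
      = exp (\<i> * complex_of_real (\<alpha> + \<beta>) / 2)"
    unfolding exp_add[symmetric] by (simp_all only: of_real_add ring_distribs add_divide_distrib)
  thus ?thesis
    by (intro eq_mat_2I[OF c Rz_gate_index(1)])
      (simp_all only: mult_mat_2_index[OF Rz_gate_index(1) Rz_gate_index(1)] Rz_gate_index
        idx mult_zero_left mult_zero_right add_0_left add_0_right)
qed

lemma Rz_gate_0: "Rz_gate 0 = 1\<^sub>m 2"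
  by (rule eq_mat_2I[OF Rz_gate_index(1)]) (simp_all add: Rz_gate_index[simplified])

lemma foldr_Rz_gate: "foldr (*) (map (\<lambda>k. Rz_gate (h k)) ks) (1\<^sub>m 2) = Rz_gate (sum_list (map h ks))"
  by (induction ks) (auto simp: Rz_gate_0 Rz_gate_mult)

text \<open>Angles of z-rotations add, so the ordered product over the coordinates collapses to one
  rotation and the order of the factors becomes irrelevant.\<close>

lemma Rz_product_eq: "Rz_product a x = Rz_gate (- inner a x)"
proof -
  have "sum_list (map (\<lambda>k. - (vec_nth a k * vec_nth x k)) (rev (sorted_list_of_set UNIV)))
      = (\<Sum>k\<in>UNIV. - (vec_nth a k * vec_nth x k))"
    by (simp add: rev_map[symmetric] sum_list_distinct_conv_sum_set)
  thus ?thesis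
    unfolding Rz_product_def foldr_Rz_gate by (simp add: inner_vec_def sum_negf)
qed

text \<open>The two Hadamard gates turn the diagonal phases \<open>exp (\<i> * t)\<close> and
  \<open>exp (- (\<i> * t))\<close> into their half sum and half difference, that is, into
  \<open>cos t\<close> and \<open>\<i> * sin t\<close> with half angle \<open>t\<close>.\<close>

lemma U1_column:
  "U1 a b x \<in> carrier_mat 2 2"
  "U1 a b x $$ (0, 0) = cos (complex_of_real ((b + inner a x) / 2))"
  "U1 a b x $$ (1, 0) = \<i> * sin (complex_of_real ((b + inner a x) / 2))"
proof -
  have idx: "(0::nat) < 2" "(1::nat) < 2" by auto
  define \<alpha> where "\<alpha> = b + inner a x"
  define t where "t = complex_of_real (\<alpha> / 2)"
  define r where "r = complex_of_real (1 / sqrt 2)"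
  have rr: "r * r = 1 / 2" unfolding r_def of_real_mult[symmetric] by simp
  note H = H_gate_index[folded r_def] and Z = Rz_gate_index[of "- \<alpha>"]
  have HZ: "H_gate * Rz_gate (- \<alpha>) \<in> carrier_mat 2 2" by (rule mult_carrier_mat[OF H(1) Z(1)])
  have U: "U1 a b x = H_gate * Rz_gate (- \<alpha>) * H_gate"
    unfolding U1_def Rz_product_eq assoc_mult_mat[OF H(1) Rz_gate_index(1) Rz_gate_index(1)] Rz_gate_mult
    by (simp add: \<alpha>_def)
  show "U1 a b x \<in> carrier_mat 2 2" unfolding U by (rule mult_carrier_mat[OF HZ H(1)])
  have e: "exp (- \<i> * complex_of_real (- \<alpha>) / 2) = exp (\<i> * t)"
    "exp (\<i> * complex_of_real (- \<alpha>) / 2) = exp (- (\<i> * t))"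
    by (simp_all add: t_def)
  have "U1 a b x $$ (i, 0) = H_gate $$ (i, 0) * exp (\<i> * t) * r + H_gate $$ (i, 1) * exp (- (\<i> * t)) * r"
    if "i < 2" for i
    unfolding U using that
    by (simp only: mult_mat_2_index[OF HZ H(1)] mult_mat_2_index[OF H(1) Z(1)] H Z e
        idx mult_zero_left mult_zero_right add_0_left add_0_right)
  from this[of 0] this[of 1]
  have "U1 a b x $$ (0, 0) = (r * r) * exp (\<i> * t) + (r * r) * exp (- (\<i> * t))"
    "U1 a b x $$ (1, 0) = (r * r) * exp (\<i> * t) - (r * r) * exp (- (\<i> * t))"
    unfolding H by (simp_all add: mult_ac)
  hence "U1 a b x $$ (0, 0) = cos t" "U1 a b x $$ (1, 0) = \<i> * sin t"
    unfolding rr exp_Euler exp_minus_Euler by (simp_all add: ring_distribs)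
  thus "U1 a b x $$ (0, 0) = cos (complex_of_real ((b + inner a x) / 2))"
    "U1 a b x $$ (1, 0) = \<i> * sin (complex_of_real ((b + inner a x) / 2))"
    unfolding t_def \<alpha>_def .
qed

text \<open>Row \<open>m\<close> of a Kronecker product of two-by-two matrices is the pair of bits
  \<open>(m div 2, m mod 2)\<close>. Rows 1 and 2 are the ones whose two bits differ, and they are
  the outcomes that the network reads.\<close>

lemma U_bar_column:
  assumes "\<theta> i = (a, b, \<gamma>)"
  shows "U_bar \<theta> i x \<in> carrier_mat 4 4"
    "U_bar \<theta> i x $$ (1, 0) = cos (complex_of_real ((b + inner a x) / 2)) * complex_of_real (sin (\<gamma> / 2))"
    "U_bar \<theta> i x $$ (2, 0) = \<i> * sin (complex_of_real ((b + inner a x) / 2)) * complex_of_real (cos (\<gamma> / 2))"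
proof -
  have d: "dim_row (U1 a b x) = 2" "dim_col (U1 a b x) = 2"
    "dim_row (U2 \<gamma>) = 2" "dim_col (U2 \<gamma>) = 2"
    using U1_column(1)[of a b x] by (auto simp: U2_def Ry_gate_def mat_of_rows_list_def)
  show "U_bar \<theta> i x \<in> carrier_mat 4 4"
    unfolding U_bar_def assms kronecker_def by (intro carrier_matI) (simp_all add: d)
  have e: "U_bar \<theta> i x $$ (m, 0) = U1 a b x $$ (m div 2, 0) * U2 \<gamma> $$ (m mod 2, 0)" if "m < 4" for m
    using that unfolding U_bar_def assms kronecker_def by (simp add: d)
  have "U2 \<gamma> $$ (0, 0) = complex_of_real (cos (\<gamma> / 2))" "U2 \<gamma> $$ (1, 0) = complex_of_real (sin (\<gamma> / 2))"
    by (simp_all add: U2_def Ry_gate_def mat_of_rows_list_def)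
  thus "U_bar \<theta> i x $$ (1, 0) = cos (complex_of_real ((b + inner a x) / 2)) * complex_of_real (sin (\<gamma> / 2))"
    "U_bar \<theta> i x $$ (2, 0) = \<i> * sin (complex_of_real ((b + inner a x) / 2)) * complex_of_real (cos (\<gamma> / 2))"
    using e[of 1] e[of 2] U1_column(2,3)[of a b x] by simp_all
qed

lemma U_bar_carrier: "U_bar \<theta> i x \<in> carrier_mat 4 4"
  using U_bar_column(1)[of \<theta> i] by (metis prod.exhaust)

section \<open>Outcome probabilities and the readout\<close>

lemma U_mat_carrier: "U_mat n \<theta> x \<in> carrier_mat (circuit_dim n) (circuit_dim n)"
proof -
  have "dim_row (U_bar \<theta> i x) = 4" "dim_col (U_bar \<theta> i x) = 4" for i
    using U_bar_carrier[of \<theta> i x] by auto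
  hence "map dim_row (map (\<lambda>i. U_bar \<theta> i x) [1..<n+1]) = replicate n 4"
    "map dim_col (map (\<lambda>i. U_bar \<theta> i x) [1..<n+1]) = replicate n 4"
    by (auto intro!: nth_equalityI simp del: upt_Suc)
  thus ?thesis
    unfolding U_mat_def circuit_dim_def
    by (intro carrier_matI) (simp_all add: dim_diag_block_mat sum_list_replicate del: upt_Suc map_map)
qed

lemma psi_index:
  assumes "k < circuit_dim n"
  shows "vec_index (psi n) k = (if k mod 4 = 0 \<and> k div 4 < n then complex_of_real (1 / sqrt (real n)) else 0)"
proof -
  have c: "(\<lambda>i. ket n (4 * i)) \<in> {0..<n} \<rightarrow> carrier_vec (circuit_dim n)" by (auto simp: ket_def)
  have "vec_index (finsum_vec TYPE(complex) (circuit_dim n) (\<lambda>i. ket n (4 * i)) {0..<n}) k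
    = (\<Sum>i\<in>{0..<n}. vec_index (ket n (4 * i)) k)"
    by (rule index_finsum_vec[OF _ assms c]) simp
  also have "\<dots> = (\<Sum>i\<in>{0..<n}. if i = k div 4 then if k mod 4 = 0 then 1 else 0 else 0)"
    using assms by (intro sum.cong) (auto simp: ket_def unit_vec_def)
  also have "\<dots> = (if k mod 4 = 0 \<and> k div 4 < n then 1 else 0)"
    by (subst sum.delta) auto
  finally show ?thesis
    using finsum_vec_closed[OF c] assms by (auto simp: psi_def)
qed

text \<open>The prepared state is supported on the multiples of 4 below \<open>4 * n\<close>, each
  the first index of a block, so only first columns contribute and different blocks do not
  interfere. The squared amplitude gives every block weight \<open>1 / n\<close>. The matrix
  \<open>V\<close> enters through its image of \<open>ket n 0\<close> alone, hence the right-hand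
  side does not mention it.\<close>

lemma outcome_prob_eq:
  assumes V: "state_prep n V" and m: "m < 4"
  shows "outcome_prob n V m \<theta> x = (\<Sum>i=1..n. (cmod (U_bar \<theta> i x $$ (m, 0)))\<^sup>2) / real n"
proof -
  have amp: "(circuit n V \<theta> x *\<^sub>v ket n 0) \<bullet>c ket n (4 * i + m)
      = complex_of_real (1 / sqrt (real n)) * U_bar \<theta> (Suc i) x $$ (m, 0)" if i: "i < n" for i
  proof -
    let ?N = "circuit_dim n"
    have N: "4 * i + m < ?N" "4 * n \<le> ?N" using i m by (auto simp: circuit_dim_def)
    have Vc: "V \<in> carrier_mat ?N ?N" and Vp: "V *\<^sub>v ket n 0 = psi n"
      using V by (auto simp: state_prep_def unitary_mat_def)
    have pc: "psi n \<in> carrier_vec ?N" unfolding Vp[symmetric] using Vc by (auto simp: ket_def)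
    have st: "circuit n V \<theta> x *\<^sub>v ket n 0 = U_mat n \<theta> x *\<^sub>v psi n"
      unfolding circuit_def Vp[symmetric]
      by (rule assoc_mult_mat_vec[OF U_mat_carrier Vc]) (simp add: ket_def)
    have "(U_mat n \<theta> x *\<^sub>v psi n) \<bullet>c ket n (4 * i + m) = vec_index (U_mat n \<theta> x *\<^sub>v psi n) (4 * i + m)"
    proof -
      \<comment> \<open>Basis vectors are real, so the inner product just extracts a
        coordinate.\<close>
      have "conjugate (ket n (4 * i + m)) = ket n (4 * i + m)"
        by (rule eq_vecI) (auto simp: ket_def unit_vec_def)
      thus ?thesis using N U_mat_carrier[of n \<theta> x] by (simp add: ket_def)
    qed
    also have "\<dots> = (\<Sum>k\<in>{0..<?N}. U_mat n \<theta> x $$ (4 * i + m, k) * vec_index (psi n) k)"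
      using N U_mat_carrier[of n \<theta> x] pc by (simp add: scalar_prod_def)
    also have "\<dots> = (\<Sum>k\<in>(\<lambda>j. 4 * j) ` {0..<n}. U_mat n \<theta> x $$ (4 * i + m, k) * vec_index (psi n) k)"
      using N by (intro sum.mono_neutral_right) (auto simp: psi_index image_iff elim: dvdE)
    also have "\<dots> = (\<Sum>j\<in>{0..<n}. U_mat n \<theta> x $$ (4 * i + m, 4 * j) * vec_index (psi n) (4 * j))"
      by (subst sum.reindex) (auto simp: inj_on_def)
    also have "\<dots> = (\<Sum>j\<in>{0..<n}. if j = i then complex_of_real (1 / sqrt (real n)) * U_bar \<theta> (Suc i) x $$ (m, 0) else 0)"
    proof (intro sum.cong refl)
      fix j assume j: "j \<in> {0..<n}"
      \<comment> \<open>The summand 0 exhibits the column as the first of block \<open>j\<close>.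
        Blocks are counted from 0 and parameters from 1, so block \<open>i\<close> carries parameter
        \<open>Suc i\<close>.\<close>
      have "U_mat n \<theta> x $$ (4 * i + m, 4 * j + 0) = (if i = j then (map (\<lambda>i. U_bar \<theta> i x) [1..<n+1] ! i) $$ (m, 0) else 0)"
        unfolding U_mat_def using i j m
        by (intro diag_block_mat_index_blocks) (auto simp: U_bar_carrier simp del: upt_Suc)
      moreover have "vec_index (psi n) (4 * j) = complex_of_real (1 / sqrt (real n))"
        using j N by (subst psi_index) auto
      ultimately show "U_mat n \<theta> x $$ (4 * i + m, 4 * j) * vec_index (psi n) (4 * j)
          = (if j = i then complex_of_real (1 / sqrt (real n)) * U_bar \<theta> (Suc i) x $$ (m, 0) else 0)"
        using i by (auto simp del: upt_Suc)
    qed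
    also have "\<dots> = complex_of_real (1 / sqrt (real n)) * U_bar \<theta> (Suc i) x $$ (m, 0)"
      using i by (subst sum.delta) auto
    finally show ?thesis unfolding st .
  qed
  have "outcome_prob n V m \<theta> x = (\<Sum>i = 0..<n. (cmod (U_bar \<theta> (Suc i) x $$ (m, 0)))\<^sup>2 / real n)"
    unfolding outcome_prob_def
    by (intro sum.cong) (auto simp: amp norm_mult norm_divide power_mult_distrib power_divide)
  also have "\<dots> = (\<Sum>i=1..n. (cmod (U_bar \<theta> i x $$ (m, 0)))\<^sup>2) / real n"
    by (simp add: sum_divide_distrib sum.atLeast1_atMost_eq atLeast0LessThan)
  finally show ?thesis .
qed

text \<open>In each block, outcomes 1 and 2 have total weight
  \<open>(1 - cos \<gamma> * cos (b + inner a x)) / 2\<close>: double-angle formulas undo the half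
  angles of the gates. The readout \<open>R - 2 * R * p\<close> then cancels the mean
  \<open>1 / 2\<close> and leaves the average of the cosine products.\<close>

lemma qnn_eq_cosine_sum:
  assumes V: "state_prep n V" and n: "n \<ge> 1"
  shows "qnn R n V \<theta> x = R / real n * (\<Sum>i=1..n. case \<theta> i of (a, b, \<gamma>) \<Rightarrow> cos \<gamma> * cos (b + inner a x))"
proof -
  have *: "(cmod (U_bar \<theta> i x $$ (1, 0)))\<^sup>2 + (cmod (U_bar \<theta> i x $$ (2, 0)))\<^sup>2
     = (1 - (case \<theta> i of (a, b, \<gamma>) \<Rightarrow> cos \<gamma> * cos (b + inner a x))) / 2" for i
  proof -
    obtain a b \<gamma> where th: "\<theta> i = (a, b, \<gamma>)" by (metis prod.exhaust)
    define s where "s = (b + inner a x) / 2"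
    define u where "u = \<gamma> / 2"
    have "(cmod (U_bar \<theta> i x $$ (1, 0)))\<^sup>2 + (cmod (U_bar \<theta> i x $$ (2, 0)))\<^sup>2
      = (cos s)\<^sup>2 * (sin u)\<^sup>2 + (sin s)\<^sup>2 * (cos u)\<^sup>2"
      unfolding U_bar_column(2,3)[where \<theta> = \<theta> and i = i, OF th] s_def[symmetric] u_def[symmetric] cos_of_real sin_of_real
      by (simp add: norm_mult power_mult_distrib)
    also have "\<dots> = (1 - cos (2 * u) * cos (2 * s)) / 2"
      unfolding cos_double by (simp add: sin_squared_eq field_simps)
    also have "\<dots> = (1 - cos \<gamma> * cos (b + inner a x)) / 2"
    proof -
      have "2 * u = \<gamma>" "2 * s = b + inner a x" by (simp_all add: s_def u_def)
      thus ?thesis by simp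
    qed
    finally show ?thesis by (simp add: th)
  qed
  have "outcome_prob n V 1 \<theta> x + outcome_prob n V 2 \<theta> x
    = (\<Sum>i=1..n. (1 - (case \<theta> i of (a, b, \<gamma>) \<Rightarrow> cos \<gamma> * cos (b + inner a x))) / 2) / real n"
    by (simp add: outcome_prob_eq[OF V] *[symmetric] sum.distrib add_divide_distrib)
  also have "\<dots> = 1 / 2 - (\<Sum>i=1..n. case \<theta> i of (a, b, \<gamma>) \<Rightarrow> cos \<gamma> * cos (b + inner a x)) / (2 * real n)"
    using n by (simp add: sum_divide_distrib[symmetric] sum_subtractf field_simps)
  finally have P: "outcome_prob n V 1 \<theta> x + outcome_prob n V 2 \<theta> x = \<dots>" .
  show ?thesis unfolding qnn_def P by (simp add: right_diff_distrib)
qed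

section \<open>Fourier inversion\<close>

text \<open>For \<open>c = 1\<close> this is the characteristic function of the standard normal law
  without its normalising constant; the substitution of \<open>c * x\<close> for \<open>x\<close>
  gives the general case.\<close>

lemma gaussian_fourier_real:
  fixes c t :: real
  assumes c: "c > 0"
  shows "integrable lborel (\<lambda>x::real. exp (\<i> * complex_of_real (t * x)) * complex_of_real (exp (- (c * x)\<^sup>2 / 2)))"
    and "(LINT x|lborel. exp (\<i> * complex_of_real (t * x)) * complex_of_real (exp (- (c * x)\<^sup>2 / 2)))
       = complex_of_real (sqrt (2 * pi) / c * exp (- (t / c)\<^sup>2 / 2))"
proof -
  let ?h = "\<lambda>u x. exp (\<i> * complex_of_real (u * x)) * complex_of_real (exp (- x\<^sup>2 / 2))"
  have std: "std_normal_density = (\<lambda>x. exp (- x\<^sup>2 / 2) / sqrt (2 * pi))"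
    by (rule ext) (simp add: std_normal_density_def)
  have "integrable lborel (\<lambda>x. sqrt (2 * pi) * std_normal_density x)"
    by simp
  hence i0: "integrable lborel (\<lambda>x::real. exp (- x\<^sup>2 / 2))"
    unfolding std by simp
  have i1: "integrable lborel (?h u)" for u :: real
    by (rule Bochner_Integration.integrable_bound[OF i0]) (auto simp: norm_mult)
  have h: "(LINT x|lborel. ?h u x) = complex_of_real (sqrt (2 * pi) * exp (- u\<^sup>2 / 2))" for u :: real
  proof -
    have "char std_normal_distribution u
        = (LINT x|lborel. std_normal_density x *\<^sub>R exp (\<i> * complex_of_real (u * x)))"
      unfolding char_def by (subst integral_density) auto
    also have "\<dots> = (LINT x|lborel. complex_of_real (1 / sqrt (2 * pi)) * ?h u x)"
      unfolding std by (intro Bochner_Integration.integral_cong refl) (simp add: scaleR_conv_of_real)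
    also have "\<dots> = complex_of_real (1 / sqrt (2 * pi)) * (LINT x|lborel. ?h u x)"
      by (rule integral_mult_right_zero)
    finally have "complex_of_real (exp (- u\<^sup>2 / 2)) = complex_of_real (1 / sqrt (2 * pi)) * (LINT x|lborel. ?h u x)"
      by (simp add: char_std_normal_distribution)
    hence "complex_of_real (sqrt (2 * pi)) * complex_of_real (exp (- u\<^sup>2 / 2)) = 
       (complex_of_real (sqrt (2 * pi)) * complex_of_real (1 / sqrt (2 * pi))) * (LINT x|lborel. ?h u x)"
      by (simp only: mult.assoc)
    also have "complex_of_real (sqrt (2 * pi)) * complex_of_real (1 / sqrt (2 * pi)) = 1"
      unfolding of_real_mult[symmetric] by simp
    finally show ?thesis by simp
  qed
  have sub: "?h (t / c) (c * x) = exp (\<i> * complex_of_real (t * x)) * complex_of_real (exp (- (c * x)\<^sup>2 / 2))" for x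
    using c by simp
  have "integrable lborel (\<lambda>x. ?h (t / c) (0 + c * x))"
    using lborel_integrable_real_affine[OF i1, of c "t / c" 0] c by blast
  thus "integrable lborel (\<lambda>x::real. exp (\<i> * complex_of_real (t * x)) * complex_of_real (exp (- (c * x)\<^sup>2 / 2)))"
    unfolding add_0_left sub .
  have "complex_of_real (sqrt (2 * pi) * exp (- (t / c)\<^sup>2 / 2)) = \<bar>c\<bar> *\<^sub>R (LINT x|lborel. ?h (t / c) (0 + c * x))"
    using lborel_integral_real_affine[of c "?h (t / c)" 0] c unfolding h by simp
  hence "complex_of_real (sqrt (2 * pi) * exp (- (t / c)\<^sup>2 / 2)) = complex_of_real c * 
      (LINT x|lborel. exp (\<i> * complex_of_real (t * x)) * complex_of_real (exp (- (c * x)\<^sup>2 / 2)))"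
    unfolding add_0_left sub using c by (simp add: scaleR_conv_of_real)
  thus "(LINT x|lborel. exp (\<i> * complex_of_real (t * x)) * complex_of_real (exp (- (c * x)\<^sup>2 / 2)))
       = complex_of_real (sqrt (2 * pi) / c * exp (- (t / c)\<^sup>2 / 2))"
    using c by (simp add: field_simps)
qed

text \<open>\<open>lborel\<close> is the image of the product of one-dimensional Lebesgue measures
  under the coordinate map, so integrals of products of coordinate functions factorise.\<close>

lemma
  fixes g :: "'a::euclidean_space \<Rightarrow> real \<Rightarrow> 'b::{real_normed_field, banach, second_countable_topology}"
  assumes g: "\<And>b. b \<in> Basis \<Longrightarrow> integrable lborel (g b)"
  shows integrable_lborel_prod_Basis: "integrable lborel (\<lambda>x::'a. \<Prod>b\<in>Basis. g b (inner x b))"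
    and integral_lborel_prod_Basis:
      "(LINT x|lborel. (\<Prod>b\<in>Basis. g b (inner x b))) = (\<Prod>b\<in>Basis. LINT t|lborel. g b t)"
proof -
  interpret product_sigma_finite "\<lambda>_::'a. lborel :: real measure"
    by standard
  let ?T = "\<lambda>f::'a \<Rightarrow> real. \<Sum>b\<in>Basis. f b *\<^sub>R b"
  have gm [measurable]: "g b \<in> borel_measurable borel" if "b \<in> Basis" for b
    using borel_measurable_integrable[OF g[OF that]] by simp
  have T [measurable]: "?T \<in> Pi\<^sub>M Basis (\<lambda>_. lborel) \<rightarrow>\<^sub>M borel" by measurable
  have m: "(\<lambda>x::'a. \<Prod>b\<in>Basis. g b (inner x b)) \<in> borel_measurable borel"
    by (intro borel_measurable_prod measurable_compose[OF _ gm]) auto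
  have eq: "(\<Prod>b\<in>Basis. g b (inner (?T f) b)) = (\<Prod>b\<in>Basis. g b (f b))" for f
    by (intro prod.cong refl) (simp add: inner_sum_left_Basis)
  show "integrable lborel (\<lambda>x::'a. \<Prod>b\<in>Basis. g b (inner x b))"
    unfolding lborel_eq[where 'a = 'a]
    by (subst integrable_distr_eq[OF T m]) (simp only: eq product_integrable_prod[OF finite_Basis g])
  show "(LINT x|lborel. (\<Prod>b\<in>Basis. g b (inner x b))) = (\<Prod>b\<in>Basis. LINT t|lborel. g b t)"
    unfolding lborel_eq[where 'a = 'a]
    by (subst integral_distr[OF T m]) (simp only: eq product_integral_prod[OF finite_Basis g])
qed

text \<open>Both the inner product and the squared norm are sums over \<open>Basis\<close>, so the
  integrand is a product of one-dimensional Gaussians with phases.\<close>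

lemma gaussian_fourier:
  fixes v :: "'a::euclidean_space" and c :: real
  assumes c: "c > 0"
  shows "integrable lborel (\<lambda>x::'a. exp (\<i> * complex_of_real (inner v x)) * complex_of_real (exp (- (c * norm x)\<^sup>2 / 2)))"
    and "(LINT x|lborel. exp (\<i> * complex_of_real (inner v x)) * complex_of_real (exp (- (c * norm x)\<^sup>2 / 2)))
      = complex_of_real ((sqrt (2 * pi) / c) ^ DIM('a) * exp (- (norm v / c)\<^sup>2 / 2))"
proof -
  let ?g = "\<lambda>b t. exp (\<i> * complex_of_real (inner v b * t)) * complex_of_real (exp (- (c * t)\<^sup>2 / 2))"
  \<comment> \<open>The factor \<open>r\<close> is kept general: it is \<open>c\<close> in the
    integrand and \<open>1 / c\<close> in its transform.\<close>
  have nrm: "(\<Sum>b\<in>Basis. (r * inner x b)\<^sup>2) = (r * norm x)\<^sup>2" for r and x :: 'a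
    by (simp add: power_mult_distrib sum_distrib_left[symmetric] power2_norm_eq_inner euclidean_inner[of x x]
        flip: power2_eq_square)
  have prod: "exp (\<i> * complex_of_real (inner v x)) * complex_of_real (exp (- (c * norm x)\<^sup>2 / 2))
     = (\<Prod>b\<in>Basis. ?g b (inner x b))" for x
  proof -
    have "(\<Prod>b\<in>Basis. exp (\<i> * complex_of_real (inner v b * inner x b))) = exp (\<i> * complex_of_real (inner v x))"
      by (simp add: exp_sum[symmetric] sum_distrib_left[symmetric] euclidean_inner[of v x])
    moreover have "(\<Prod>b\<in>Basis. complex_of_real (exp (- (c * inner x b)\<^sup>2 / 2)))
       = complex_of_real (exp (- (c * norm x)\<^sup>2 / 2))"
      by (simp add: nrm[symmetric] sum_negf sum_divide_distrib exp_sum[symmetric] of_real_prod[symmetric] del: of_real_prod)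
    ultimately show ?thesis by (simp only: prod.distrib)
  qed
  show "integrable lborel (\<lambda>x::'a. exp (\<i> * complex_of_real (inner v x)) * complex_of_real (exp (- (c * norm x)\<^sup>2 / 2)))"
    unfolding prod by (rule integrable_lborel_prod_Basis[OF gaussian_fourier_real(1)[OF c]])
  have "(LINT x|lborel. exp (\<i> * complex_of_real (inner v x)) * complex_of_real (exp (- (c * norm x)\<^sup>2 / 2)))
    = (\<Prod>b\<in>Basis. complex_of_real (sqrt (2 * pi) / c * exp (- (inner v b / c)\<^sup>2 / 2)))"
    unfolding prod integral_lborel_prod_Basis[OF gaussian_fourier_real(1)[OF c]] gaussian_fourier_real(2)[OF c] ..
  also have "\<dots> = complex_of_real ((sqrt (2 * pi) / c) ^ DIM('a) * (\<Prod>b\<in>Basis. exp (- (inner v b / c)\<^sup>2 / 2)))"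
    by (simp only: of_real_prod[symmetric] prod.distrib prod_constant)
  also have "(\<Prod>b\<in>Basis. exp (- (inner v b / c)\<^sup>2 / 2)) = exp (- (norm v / c)\<^sup>2 / 2)"
    using nrm[of "1 / c" v] by (simp add: exp_sum[symmetric] sum_negf sum_divide_distrib[symmetric])
  finally show "(LINT x|lborel. exp (\<i> * complex_of_real (inner v x)) * complex_of_real (exp (- (c * norm x)\<^sup>2 / 2)))
      = complex_of_real ((sqrt (2 * pi) / c) ^ DIM('a) * exp (- (norm v / c)\<^sup>2 / 2))" .
qed

section \<open>Gaussian kernels as an approximate identity\<close>

lemma integral_lborel_affine:
  fixes g :: "'a::euclidean_space \<Rightarrow> 'b::{banach, second_countable_topology}"
  assumes [measurable]: "g \<in> borel_measurable borel" and c: "c > 0"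
  shows "(LINT y|lborel. g y) = c ^ DIM('a) *\<^sub>R (LINT z|lborel. g (t + c *\<^sub>R z))"
  using c by (subst lborel_affine[of c t]) (simp_all add: integral_density integral_distr)

text \<open>The transform at frequency 0 with \<open>c = 2 * pi\<close>. It fixes the constant that
  gives the kernels below unit mass.\<close>

lemma gaussian_kernel_integral:
  shows "integrable lborel (\<lambda>z::'a::euclidean_space. exp (- (2 * pi * norm z)\<^sup>2 / 2))"
    and "sqrt (2 * pi) ^ DIM('a) * (LINT z::'a|lborel. exp (- (2 * pi * norm z)\<^sup>2 / 2)) = 1"
proof -
  have *: "exp (\<i> * complex_of_real (inner 0 z)) * complex_of_real (exp (- (2 * pi * norm z)\<^sup>2 / 2))
     = complex_of_real (exp (- (2 * pi * norm z)\<^sup>2 / 2))" for z :: 'a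
    by simp
  note G = gaussian_fourier[where v = "0 :: 'a" and c = "2 * pi", unfolded *]
  show "integrable lborel (\<lambda>z::'a. exp (- (2 * pi * norm z)\<^sup>2 / 2))"
    using G(1) unfolding complex_of_real_integrable_eq by simp
  have "(LINT z::'a|lborel. exp (- (2 * pi * norm z)\<^sup>2 / 2)) = (sqrt (2 * pi) / (2 * pi)) ^ DIM('a)"
    using G(2) unfolding integral_complex_of_real of_real_eq_iff by simp
  thus "sqrt (2 * pi) ^ DIM('a) * (LINT z::'a|lborel. exp (- (2 * pi * norm z)\<^sup>2 / 2)) = 1"
    by (simp add: power_mult_distrib[symmetric])
qed

text \<open>The kernel has unit mass and width of order \<open>1 / Suc k\<close>, so its mass
  concentrates at \<open>x\<close>, where \<open>f\<close> is continuous. The scale is the one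
  produced by regularising the inversion integral with \<open>c = 1 / Suc k\<close>.\<close>

lemma gaussian_approximate_identity:
  fixes f :: "'a::euclidean_space \<Rightarrow> real" and x :: 'a
  assumes cont: "continuous_on UNIV f" and int: "integrable lborel f"
  shows "(\<lambda>k. LINT y|lborel. f y * ((sqrt (2 * pi) * real (Suc k)) ^ DIM('a) *
            exp (- (2 * pi * real (Suc k) * norm (x - y))\<^sup>2 / 2))) \<longlonglongrightarrow> f x"
proof -
  let ?d = "DIM('a)"
  let ?K = "\<lambda>k y. (sqrt (2 * pi) * real (Suc k)) ^ ?d * exp (- (2 * pi * real (Suc k) * norm (x - y))\<^sup>2 / 2)"
  let ?G = "\<lambda>z::'a. exp (- (2 * pi * norm z)\<^sup>2 / 2)"
  define f1 where "f1 = (\<lambda>y. indicator (ball x 1) y * f y)"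
  define f2 where "f2 = (\<lambda>y. indicator (- ball x 1) y * f y)"
  have fm [measurable]: "f \<in> borel_measurable borel"
    using borel_measurable_continuous_onI[OF cont] .
  have f1m [measurable]: "f1 \<in> borel_measurable borel" and f2m [measurable]: "f2 \<in> borel_measurable borel"
    unfolding f1_def f2_def by (intro borel_measurable_times borel_measurable_indicator fm; simp)+
  have f12: "f y = f1 y + f2 y" for y
    by (auto simp: f1_def f2_def indicator_def)
  have "bounded (f ` cball x 1)"
    by (intro compact_imp_bounded compact_continuous_image continuous_on_subset[OF cont] compact_cball) simp
  then obtain M where M: "\<And>y. y \<in> cball x 1 \<Longrightarrow> \<bar>f y\<bar> \<le> M"
    unfolding bounded_iff by (metis imageI real_norm_def)
  \<comment> \<open>Outside the ball \<open>f1\<close> is 0; the instance at \<open>x\<close> shows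
    that \<open>M\<close> is nonnegative.\<close>
  have f1M: "\<bar>f1 y\<bar> \<le> M" for y
    using M[of y] M[of x] by (auto simp: f1_def indicator_def)
  have KC: "\<bar>?K k y\<bar> \<le> (sqrt (2 * pi) * real (Suc k)) ^ ?d" for k y
    by (simp add: abs_mult mult_le_cancel_left1)
  have intK: "integrable lborel (\<lambda>y. h y * ?K k y)" if "integrable lborel h" for h :: "'a \<Rightarrow> real" and k
    by (rule Bochner_Integration.integrable_bound[OF integrable_mult_left[OF integrable_abs[OF that], of "(sqrt (2 * pi) * real (Suc k)) ^ ?d"]])
       (use borel_measurable_integrable[OF that] KC[of k] in \<open>auto simp: abs_mult intro!: mult_left_mono AE_I2\<close>)
  have int1: "integrable lborel f1" and int2: "integrable lborel f2"
    unfolding f1_def f2_def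
    using integrable_mult_indicator[of _ lborel f] int by auto
  \<comment> \<open>\<open>f\<close> need not be bounded, so it is split at the unit sphere around \<open>x\<close>: dominated
    convergence handles the bounded near part, the decay of the kernel the far part.\<close>
  have near: "(\<lambda>k. LINT y|lborel. f1 y * ?K k y) \<longlonglongrightarrow> f x"
  proof -
    have eq: "(LINT y|lborel. f1 y * ?K k y)
        = sqrt (2 * pi) ^ ?d * (LINT z|lborel. f1 (x + (1 / real (Suc k)) *\<^sub>R z) * ?G z)" for k
    proof -
      let ?r = "1 / real (Suc k)"
      have "(LINT y|lborel. f1 y * ?K k y)
          = ?r ^ ?d *\<^sub>R (LINT z|lborel. f1 (x + ?r *\<^sub>R z) * ?K k (x + ?r *\<^sub>R z))"
        by (rule integral_lborel_affine) simp_all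
      also have "(\<lambda>z. f1 (x + ?r *\<^sub>R z) * ?K k (x + ?r *\<^sub>R z))
          = (\<lambda>z. (sqrt (2 * pi) * real (Suc k)) ^ ?d * (f1 (x + ?r *\<^sub>R z) * ?G z))"
      proof
        fix z
        have "2 * pi * real (Suc k) * norm (x - (x + ?r *\<^sub>R z)) = 2 * pi * norm z"
          by (simp del: of_nat_Suc)
        thus "f1 (x + ?r *\<^sub>R z) * ?K k (x + ?r *\<^sub>R z) = (sqrt (2 * pi) * real (Suc k)) ^ ?d * (f1 (x + ?r *\<^sub>R z) * ?G z)"
          by (simp only: mult_ac)
      qed
      also have "?r ^ ?d *\<^sub>R (LINT z|lborel. (sqrt (2 * pi) * real (Suc k)) ^ ?d * (f1 (x + ?r *\<^sub>R z) * ?G z))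
          = (?r ^ ?d * (sqrt (2 * pi) * real (Suc k)) ^ ?d) * (LINT z|lborel. f1 (x + ?r *\<^sub>R z) * ?G z)"
        by (simp only: integral_mult_right_zero real_scaleR_def mult.assoc)
      \<comment> \<open>The Jacobian of the rescaling cancels the growth of the kernel's height, so
        \<open>k\<close> survives only in the argument of \<open>f1\<close>.\<close>
      also have "?r ^ ?d * (sqrt (2 * pi) * real (Suc k)) ^ ?d = sqrt (2 * pi) ^ ?d"
        by (simp add: power_mult_distrib[symmetric] del: of_nat_Suc)
      finally show ?thesis .
    qed
    have "(\<lambda>k. LINT z|lborel. f1 (x + (1 / real (Suc k)) *\<^sub>R z) * ?G z) \<longlonglongrightarrow> (LINT z|lborel. f x * ?G z)"
    proof (rule integral_dominated_convergence[where w = "\<lambda>z. M * ?G z"])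
      show "integrable lborel (\<lambda>z. M * ?G z)"
        using gaussian_kernel_integral(1) by (rule integrable_mult_right)
      show "AE z in lborel. (\<lambda>k. f1 (x + (1 / real (Suc k)) *\<^sub>R z) * ?G z) \<longlonglongrightarrow> f x * ?G z"
      proof (intro AE_I2 tendsto_mult tendsto_const)
        fix z :: 'a
        have "(\<lambda>k. x + (1 / real (Suc k)) *\<^sub>R z) \<longlonglongrightarrow> x + 0 *\<^sub>R z"
          by (intro tendsto_intros LIMSEQ_Suc[OF lim_1_over_n])
        hence l: "(\<lambda>k. x + (1 / real (Suc k)) *\<^sub>R z) \<longlonglongrightarrow> x" by simp
        have "isCont f x" using cont by (simp add: continuous_on_eq_continuous_at)
        hence fl: "(\<lambda>k. f (x + (1 / real (Suc k)) *\<^sub>R z)) \<longlonglongrightarrow> f x"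
          by (rule isCont_tendsto_compose[OF _ l])
        \<comment> \<open>For fixed \<open>z\<close> the points end up inside the ball, where the
          truncation \<open>f1\<close> agrees with \<open>f\<close>.\<close>
        have "\<forall>\<^sub>F k in sequentially. x + (1 / real (Suc k)) *\<^sub>R z \<in> ball x 1"
          using l by (rule topological_tendstoD) auto
        hence "\<forall>\<^sub>F k in sequentially. f (x + (1 / real (Suc k)) *\<^sub>R z) = f1 (x + (1 / real (Suc k)) *\<^sub>R z)"
          by eventually_elim (simp add: f1_def)
        thus "(\<lambda>k. f1 (x + (1 / real (Suc k)) *\<^sub>R z)) \<longlonglongrightarrow> f x"
          using fl by (rule Lim_transform_eventually[rotated])
      qed
      show "AE z in lborel. norm (f1 (x + (1 / real (Suc k)) *\<^sub>R z) * ?G z) \<le> M * ?G z" for k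
        using f1M by (intro AE_I2) (simp add: abs_mult mult_right_mono)
    qed measurable
    hence "(\<lambda>k. sqrt (2 * pi) ^ ?d * (LINT z|lborel. f1 (x + (1 / real (Suc k)) *\<^sub>R z) * ?G z)) 
       \<longlonglongrightarrow> sqrt (2 * pi) ^ ?d * (LINT z|lborel. f x * ?G z)"
      by (intro tendsto_mult tendsto_const)
    also have "sqrt (2 * pi) ^ ?d * (LINT z|lborel. f x * ?G z) = f x * (sqrt (2 * pi) ^ ?d * (LINT z|lborel. ?G z))"
      by (simp only: integral_mult_right_zero mult_ac)
    finally show ?thesis unfolding eq gaussian_kernel_integral(2) by simp
  qed
  have far: "(\<lambda>k. LINT y|lborel. f2 y * ?K k y) \<longlonglongrightarrow> 0"
  proof (rule Lim_null_comparison)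
    let ?a = "\<lambda>k. sqrt (2 * pi) ^ ?d * (real (Suc k) ^ ?d / exp (real (Suc k)))"
    have "(\<lambda>k. real (Suc k) ^ ?d / exp (real (Suc k))) \<longlonglongrightarrow> 0"
      by (rule filterlim_compose[OF tendsto_power_div_exp_0])
         (rule filterlim_compose[OF filterlim_real_sequentially filterlim_Suc])
    hence "(\<lambda>k. sqrt (2 * pi) ^ ?d * (real (Suc k) ^ ?d / exp (real (Suc k))) * (LINT y|lborel. \<bar>f2 y\<bar>))
        \<longlonglongrightarrow> sqrt (2 * pi) ^ ?d * 0 * (LINT y|lborel. \<bar>f2 y\<bar>)"
      by (intro tendsto_mult tendsto_const)
    thus "(\<lambda>k. ?a k * (LINT y|lborel. \<bar>f2 y\<bar>)) \<longlonglongrightarrow> 0" by simp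
    \<comment> \<open>Off the unit ball, with \<open>s = Suc k\<close>, the chain \<open>2 * s \<le>
      (pi * s)\<^sup>2 \<le> (2 * pi * s * norm (x - y))\<^sup>2\<close> bounds the Gaussian by
      \<open>exp (- s)\<close>, which beats the factor \<open>s ^ ?d\<close>.\<close>
    have bd: "\<bar>f2 y * ?K k y\<bar> \<le> ?a k * \<bar>f2 y\<bar>" for k y
    proof (cases "y \<in> ball x 1")
      case False
      let ?s = "real (Suc k)"
      have "1 \<le> norm (x - y)" using False by (simp add: dist_norm)
      hence "?s * 1 \<le> ?s * norm (x - y)" by (intro mult_left_mono) auto
      hence s: "?s \<le> ?s * norm (x - y)" by simp
      have s1: "1 \<le> ?s" by simp
      have "2 * ?s \<le> (2 * ?s) * ?s" using s1 by (simp add: mult_le_cancel_left1)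
      also have "\<dots> \<le> (pi * ?s) * (pi * ?s)"
      proof -
        have "2 * 1 \<le> pi * pi" using pi_ge_two by (intro mult_mono) auto
        hence "2 * (?s * ?s) \<le> (pi * pi) * (?s * ?s)" by (intro mult_right_mono) auto
        thus ?thesis by (simp only: mult_ac)
      qed
      also have "\<dots> = (pi * ?s)\<^sup>2" by (simp only: power2_eq_square)
      also have "\<dots> \<le> (2 * pi * ?s * norm (x - y))\<^sup>2"
      proof (rule power_mono)
        have "pi * ?s \<le> pi * (?s * norm (x - y))" using s by (intro mult_left_mono) auto
        also have "\<dots> \<le> 2 * (pi * (?s * norm (x - y)))" by simp
        finally show "pi * ?s \<le> 2 * pi * ?s * norm (x - y)" by (simp only: mult_ac)
      qed simp
      finally have "exp (- (2 * pi * ?s * norm (x - y))\<^sup>2 / 2) \<le> exp (- ?s)" by simp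
      hence "?K k y \<le> (sqrt (2 * pi) * ?s) ^ ?d * exp (- ?s)" by (intro mult_left_mono) auto
      also have "\<dots> = ?a k" by (simp add: power_mult_distrib exp_minus divide_inverse del: of_nat_Suc)
      finally have "\<bar>f2 y\<bar> * ?K k y \<le> \<bar>f2 y\<bar> * ?a k" by (intro mult_left_mono) auto
      thus ?thesis by (simp add: abs_mult mult_ac del: of_nat_Suc)
    qed (simp add: f2_def)
    show "\<forall>\<^sub>F k in sequentially. norm (LINT y|lborel. f2 y * ?K k y) \<le> ?a k * (LINT y|lborel. \<bar>f2 y\<bar>)"
    proof (rule always_eventually, rule allI)
      fix k
      have "norm (LINT y|lborel. f2 y * ?K k y) \<le> (LINT y|lborel. norm (f2 y * ?K k y))"
        by (rule integral_norm_bound)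
      also have "\<dots> \<le> (LINT y|lborel. ?a k * \<bar>f2 y\<bar>)"
        using bd[of _ k] by (intro integral_mono integrable_norm intK int2 integrable_mult_right integrable_abs) simp_all
      also have "\<dots> = ?a k * (LINT y|lborel. \<bar>f2 y\<bar>)" by (rule integral_mult_right_zero)
      finally show "norm (LINT y|lborel. f2 y * ?K k y) \<le> ?a k * (LINT y|lborel. \<bar>f2 y\<bar>)" .
    qed
  qed
  have "(LINT y|lborel. f y * ?K k y) = (LINT y|lborel. f1 y * ?K k y) + (LINT y|lborel. f2 y * ?K k y)" for k
    unfolding f12[of _] ring_distribs by (intro Bochner_Integration.integral_add intK int1 int2)
  thus ?thesis using tendsto_add[OF near far] by simp
qed

section \<open>The inversion formula\<close>

text \<open>The Gaussian weight makes the double integral absolutely convergent, so the order of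
  integration can be exchanged. The integral over \<xi> is then the Gaussian transform at
  \<open>(2 * pi) *\<^sub>R (x - y)\<close>, which yields the kernel.\<close>

lemma fourier_regularized_inversion:
  fixes f :: "real ^ 'd \<Rightarrow> real" and x :: "real ^ 'd"
  assumes int: "integrable lborel f" and c: "c > 0"
  shows "(LINT \<xi>|lborel. fourier f \<xi> * exp (2 * complex_of_real pi * \<i> * complex_of_real (inner x \<xi>)) *
            complex_of_real (exp (- (c * norm \<xi>)\<^sup>2 / 2)))
       = complex_of_real (LINT y|lborel. f y * ((sqrt (2 * pi) / c) ^ DIM(real ^ 'd) *
            exp (- (2 * pi / c * norm (x - y))\<^sup>2 / 2)))"
proof -
  let ?w = "\<lambda>\<xi>::real ^ 'd. exp (- (c * norm \<xi>)\<^sup>2 / 2)"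
  let ?e = "\<lambda>y \<xi>. exp (\<i> * complex_of_real (inner ((2 * pi) *\<^sub>R (x - y)) \<xi>))"
  let ?F = "\<lambda>y \<xi>. complex_of_real (f y) * (?e y \<xi> * complex_of_real (?w \<xi>))"
  have fm [measurable]: "f \<in> borel_measurable borel"
    using borel_measurable_integrable[OF int] by simp
  have wint: "integrable lborel ?w"
  proof -
    have "integrable lborel (\<lambda>\<xi>::real ^ 'd. cmod (exp (\<i> * complex_of_real (inner 0 \<xi>)) * complex_of_real (?w \<xi>)))"
      by (intro integrable_norm gaussian_fourier(1) c)
    thus ?thesis by (simp add: norm_mult)
  qed
  have nF: "norm (?F y \<xi>) = \<bar>f y\<bar> * ?w \<xi>" for y \<xi>
    by (simp add: norm_mult)
  \<comment> \<open>The norm of the integrand is a product of an integrable function of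
    \<open>y\<close> and one of \<xi>.\<close>
  have Fint: "integrable (lborel \<Otimes>\<^sub>M lborel) (\<lambda>(y, \<xi>). ?F y \<xi>)"
  proof (rule lborel_pair.Fubini_integrable)
    have "(\<lambda>p. ?F (fst p) (snd p)) \<in> borel_measurable (lborel \<Otimes>\<^sub>M lborel)"
      by measurable
    thus "(\<lambda>(y, \<xi>). ?F y \<xi>) \<in> borel_measurable (lborel \<Otimes>\<^sub>M lborel)"
      by (simp add: case_prod_unfold)
    show "integrable lborel (\<lambda>y. LINT \<xi>|lborel. norm (case (y, \<xi>) of (y, \<xi>) \<Rightarrow> ?F y \<xi>))"
      unfolding prod.case nF integral_mult_right_zero by (intro integrable_mult_left integrable_abs int)
    show "AE y in lborel. integrable lborel (\<lambda>\<xi>. case (y, \<xi>) of (y, \<xi>) \<Rightarrow> ?F y \<xi>)"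
      unfolding prod.case by (intro AE_I2 integrable_mult_right gaussian_fourier(1) c)
  qed
  have inner_form: "fourier f \<xi> * exp (2 * complex_of_real pi * \<i> * complex_of_real (inner x \<xi>)) * complex_of_real (?w \<xi>)
      = (LINT y|lborel. ?F y \<xi>)" for \<xi>
  proof -
    have "fourier f \<xi> * exp (2 * complex_of_real pi * \<i> * complex_of_real (inner x \<xi>)) * complex_of_real (?w \<xi>)
       = (LINT y|lborel. exp (- 2 * complex_of_real pi * \<i> * complex_of_real (inner y \<xi>)) * complex_of_real (f y) *
            (exp (2 * complex_of_real pi * \<i> * complex_of_real (inner x \<xi>)) * complex_of_real (?w \<xi>)))"
      unfolding fourier_def integral_mult_left_zero by (simp only: mult.assoc)
    also have "\<dots> = (LINT y|lborel. ?F y \<xi>)"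
    proof (intro Bochner_Integration.integral_cong refl)
      fix y
      have "exp (- 2 * complex_of_real pi * \<i> * complex_of_real (inner y \<xi>)) *
          exp (2 * complex_of_real pi * \<i> * complex_of_real (inner x \<xi>)) = ?e y \<xi>"
        unfolding exp_add[symmetric] by (simp add: inner_diff_left algebra_simps)
      thus "exp (- 2 * complex_of_real pi * \<i> * complex_of_real (inner y \<xi>)) * complex_of_real (f y) *
            (exp (2 * complex_of_real pi * \<i> * complex_of_real (inner x \<xi>)) * complex_of_real (?w \<xi>)) = ?F y \<xi>"
        by (simp add: mult_ac)
    qed
    finally show ?thesis .
  qed
  have "(LINT \<xi>|lborel. fourier f \<xi> * exp (2 * complex_of_real pi * \<i> * complex_of_real (inner x \<xi>)) * complex_of_real (?w \<xi>))
     = (LINT y|lborel. LINT \<xi>|lborel. ?F y \<xi>)"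
    unfolding inner_form by (rule lborel_pair.Fubini_integral[OF Fint])
  also have "\<dots> = (LINT y|lborel. complex_of_real (f y * ((sqrt (2 * pi) / c) ^ DIM(real ^ 'd) *
            exp (- (2 * pi / c * norm (x - y))\<^sup>2 / 2))))"
    unfolding integral_mult_right_zero gaussian_fourier(2)[OF c] of_real_mult[symmetric]
    by simp
  also have "\<dots> = complex_of_real (LINT y|lborel. f y * ((sqrt (2 * pi) / c) ^ DIM(real ^ 'd) *
            exp (- (2 * pi / c * norm (x - y))\<^sup>2 / 2)))"
    by (rule integral_complex_of_real)
  finally show ?thesis .
qed

text \<open>The weight is removed by letting \<open>c = 1 / Suc k\<close> tend to 0. The frequency
  side converges by domination with the norm of \<open>fourier f\<close>, the space side by the
  approximate identity, and the two limits agree.\<close>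

lemma fourier_inversion:
  fixes f :: "real ^ 'd \<Rightarrow> real" and x :: "real ^ 'd"
  assumes cont: "continuous_on UNIV f" and int: "integrable lborel f"
    and fint: "integrable lborel (fourier f)"
  shows "(LINT \<xi>|lborel. fourier f \<xi> * exp (2 * complex_of_real pi * \<i> * complex_of_real (inner x \<xi>)))
    = complex_of_real (f x)"
proof -
  let ?E = "\<lambda>\<xi>. fourier f \<xi> * exp (2 * complex_of_real pi * \<i> * complex_of_real (inner x \<xi>))"
  let ?w = "\<lambda>k \<xi>::real ^ 'd. exp (- (1 / real (Suc k) * norm \<xi>)\<^sup>2 / 2)"
  have [measurable]: "fourier f \<in> borel_measurable borel"
    using borel_measurable_integrable[OF fint] by simp
  have nE: "norm (exp (2 * complex_of_real pi * \<i> * complex_of_real r)) = 1" for r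
    by (simp add: norm_exp_eq_Re)
  have "(\<lambda>k. LINT \<xi>|lborel. ?E \<xi> * complex_of_real (?w k \<xi>)) \<longlonglongrightarrow> (LINT \<xi>|lborel. ?E \<xi>)"
  proof (rule integral_dominated_convergence[where w = "\<lambda>\<xi>. norm (fourier f \<xi>)"])
    show "integrable lborel (\<lambda>\<xi>. norm (fourier f \<xi>))" using fint by (rule integrable_norm)
    show "AE \<xi> in lborel. (\<lambda>k. ?E \<xi> * complex_of_real (?w k \<xi>)) \<longlonglongrightarrow> ?E \<xi>"
    proof (rule AE_I2)
      fix \<xi> :: "real ^ 'd"
      have "(\<lambda>k. ?E \<xi> * complex_of_real (?w k \<xi>)) \<longlonglongrightarrow> ?E \<xi> * complex_of_real (exp (- (0 * norm \<xi>)\<^sup>2 / 2))"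
        by (intro tendsto_intros LIMSEQ_Suc[OF lim_1_over_n]) simp
      thus "(\<lambda>k. ?E \<xi> * complex_of_real (?w k \<xi>)) \<longlonglongrightarrow> ?E \<xi>" by simp
    qed
    show "AE \<xi> in lborel. norm (?E \<xi> * complex_of_real (?w k \<xi>)) \<le> norm (fourier f \<xi>)" for k
      by (intro AE_I2) (simp add: norm_mult nE mult_le_cancel_left2 del: of_nat_Suc)
  qed measurable
  moreover have "(\<lambda>k. LINT \<xi>|lborel. ?E \<xi> * complex_of_real (?w k \<xi>)) \<longlonglongrightarrow> complex_of_real (f x)"
  proof -
    have "(LINT \<xi>|lborel. ?E \<xi> * complex_of_real (?w k \<xi>)) =
       complex_of_real (LINT y|lborel. f y * ((sqrt (2 * pi) * real (Suc k)) ^ DIM(real ^ 'd) *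
            exp (- (2 * pi * real (Suc k) * norm (x - y))\<^sup>2 / 2)))" for k
      using fourier_regularized_inversion[OF int, of "1 / real (Suc k)" x]
      by (simp del: of_nat_Suc DIM_cart)
    thus ?thesis
      by (simp only:) (intro tendsto_of_real gaussian_approximate_identity cont int)
  qed
  ultimately show ?thesis by (rule LIMSEQ_unique)
qed

section \<open>Greedy sampling\<close>

text \<open>
  If \<open>t\<close> is drawn from \<open>N\<close>, the mean of \<open>g t x - f x\<close> vanishes, so the cross term with \<open>S\<close> drops
  out on average and some \<open>t\<close> does at least as well as the mean.
\<close>

lemma greedy_step:
  fixes g :: "'b \<Rightarrow> 'a \<Rightarrow> real" and L :: real
  assumes M: "prob_space M" and N: "prob_space N"
    and gm: "(\<lambda>(x, t). g t x) \<in> borel_measurable (M \<Otimes>\<^sub>M N)"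
    and fm: "f \<in> borel_measurable M" and Sm: "S \<in> borel_measurable M"
    and gb: "\<And>t x. \<bar>g t x\<bar> \<le> L" and Sb: "\<And>x. \<bar>S x\<bar> \<le> B"
    and gf: "\<And>x. x \<in> space M \<Longrightarrow> (LINT t|N. g t x) = f x"
  shows "\<exists>t\<in>space N. (LINT x|M. (S x + (g t x - f x))\<^sup>2) \<le> (LINT x|M. (S x)\<^sup>2) + L\<^sup>2"
proof -
  interpret M: prob_space M by fact
  interpret N: prob_space N by fact
  interpret P: pair_prob_space M N ..
  note [measurable] = gm fm Sm
  have gx: "(\<lambda>t. g t x) \<in> borel_measurable N" if "x \<in> space M" for x
    using measurable_Pair2[OF gm that] by simp
  have L0: "0 \<le> L" using gb[of undefined undefined] by linarith
  have intg: "integrable N (\<lambda>t. g t x)" if "x \<in> space M" for x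
    using gx[OF that] gb by (intro N.integrable_const_bound[of _ L]) auto
  have intg2: "integrable N (\<lambda>t. (g t x)\<^sup>2)" if "x \<in> space M" for x
    using gx[OF that] gb by (intro N.integrable_const_bound[of _ "L\<^sup>2"]) (auto intro!: abs_le_square_iff[THEN iffD1] order_trans[OF _ abs_ge_self])
  \<comment> \<open>As a mean of values bounded by \<open>L\<close>, \<open>f\<close> inherits the
    bound; this makes \<open>?H\<close> bounded and hence integrable on the product.\<close>
  have fb: "\<bar>f x\<bar> \<le> L" if "x \<in> space M" for x
  proof -
    have "norm (LINT t|N. g t x) \<le> (LINT t|N. norm (g t x))" by (rule integral_norm_bound)
    also have "\<dots> \<le> (LINT t|N. L)"
      using gb intg[OF that] by (intro integral_mono) auto
    finally show ?thesis using gf[OF that] by (simp add: N.prob_space)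
  qed
  let ?H = "\<lambda>x t. (S x + (g t x - f x))\<^sup>2"
  have Hb: "\<bar>?H x t\<bar> \<le> (B + 2 * L)\<^sup>2" if "x \<in> space M" for x t
  proof -
    have "\<bar>S x + (g t x - f x)\<bar> \<le> B + 2 * L" using Sb[of x] gb[of t x] fb[OF that] by linarith
    thus ?thesis by (simp add: abs_le_square_iff[symmetric])
  qed
  have Hm: "(\<lambda>(x, t). ?H x t) \<in> borel_measurable (M \<Otimes>\<^sub>M N)"
    by measurable
  have Hint: "integrable (M \<Otimes>\<^sub>M N) (\<lambda>(x, t). ?H x t)"
    using Hm Hb by (intro P.integrable_const_bound[of _ "(B + 2 * L)\<^sup>2"])
      (auto simp: space_pair_measure intro!: AE_I2)
  let ?C = "(LINT x|M. (S x)\<^sup>2) + L\<^sup>2"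
  have S2: "integrable M (\<lambda>x. (S x)\<^sup>2)"
    using Sb by (intro M.integrable_const_bound[of _ "B\<^sup>2"]) (auto intro!: abs_le_square_iff[THEN iffD1] order_trans[OF _ abs_ge_self])
  have "(LINT t|N. LINT x|M. ?H x t) = (LINT x|M. LINT t|N. ?H x t)"
    by (rule P.Fubini_integral[OF Hint])
  also have "\<dots> \<le> (LINT x|M. (S x)\<^sup>2 + L\<^sup>2)"
  proof (rule integral_mono)
    show "integrable M (\<lambda>x. LINT t|N. ?H x t)" using P.integrable_fst[OF Hint] .
    show "integrable M (\<lambda>x. (S x)\<^sup>2 + L\<^sup>2)" using S2 by simp
    fix x assume x: "x \<in> space M"
    \<comment> \<open>Expanding around \<open>S x - f x\<close> isolates a term linear in
      \<open>g\<close>, whose mean is known. The first two terms then average to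
      \<open>(S x)\<^sup>2 - (f x)\<^sup>2\<close>, and the negative square is dropped.\<close>
    have "(LINT t|N. ?H x t) = (LINT t|N. ((S x - f x)\<^sup>2 + 2 * (S x - f x) * g t x) + (g t x)\<^sup>2)"
      by (intro Bochner_Integration.integral_cong refl) (simp add: power2_eq_square algebra_simps)
    also have "\<dots> = (S x - f x)\<^sup>2 + 2 * (S x - f x) * f x + (LINT t|N. (g t x)\<^sup>2)"
      using intg[OF x] intg2[OF x] gf[OF x] by (simp add: N.prob_space)
    also have "\<dots> = (S x)\<^sup>2 - (f x)\<^sup>2 + (LINT t|N. (g t x)\<^sup>2)"
      by (simp add: power2_eq_square algebra_simps)
    also have "(LINT t|N. (g t x)\<^sup>2) \<le> (LINT t|N. L\<^sup>2)"
      using intg2[OF x] gb by (intro integral_mono) (auto intro!: abs_le_square_iff[THEN iffD1] order_trans[OF _ abs_ge_self])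
    also have "(S x)\<^sup>2 - (f x)\<^sup>2 + (LINT t|N. L\<^sup>2) \<le> (S x)\<^sup>2 + L\<^sup>2"
      by (simp add: N.prob_space)
    finally show "(LINT t|N. ?H x t) \<le> (S x)\<^sup>2 + L\<^sup>2" by simp
  qed
  also have "\<dots> = ?C" using S2 by (simp add: M.prob_space)
  finally have le: "(LINT t|N. LINT x|M. ?H x t) \<le> ?C" .
  show ?thesis
  proof (rule ccontr)
    \<comment> \<open>If every \<open>t\<close> did worse than \<open>?C\<close>, the mean would
      strictly exceed \<open>?C\<close>, since \<open>N\<close> has total mass 1.\<close>
    assume "\<not> ?thesis"
    hence "AE t in N. ?C < (LINT x|M. ?H x t)" by (intro AE_I2) (auto simp: not_le)
    hence "(LINT t|N. ?C) < (LINT t|N. LINT x|M. ?H x t)"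
      using P.integrable_snd[OF Hint] N.emeasure_space_1 by (intro N.integral_less_AE_space) auto
    thus False using le by (simp add: N.prob_space)
  qed
qed

text \<open>A derandomised form of Maurey's argument: each greedy choice adds at most
  \<open>L\<^sup>2\<close>, as the variance of an independent sample would. Division by the squared
  number of samples later gives the rate.\<close>

lemma maurey_sampling:
  fixes g :: "'b \<Rightarrow> 'a \<Rightarrow> real" and L :: real
  assumes M: "prob_space M" and N: "prob_space N"
    and gm: "(\<lambda>(x, t). g t x) \<in> borel_measurable (M \<Otimes>\<^sub>M N)"
    and fm: "f \<in> borel_measurable M"
    and gb: "\<And>t x. \<bar>g t x\<bar> \<le> L" and fb: "\<And>x. \<bar>f x\<bar> \<le> L"
    and gf: "\<And>x. x \<in> space M \<Longrightarrow> (LINT t|N. g t x) = f x"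
  shows "\<exists>t :: nat \<Rightarrow> 'b. (\<forall>i\<in>{1..n}. t i \<in> space N) \<and>
     (LINT x|M. (\<Sum>i=1..n. g (t i) x - f x)\<^sup>2) \<le> real n * L\<^sup>2"
proof (induction n)
  case 0
  show ?case by simp
next
  case (Suc n)
  then obtain t where t: "\<forall>i\<in>{1..n}. t i \<in> space N"
    "(LINT x|M. (\<Sum>i=1..n. g (t i) x - f x)\<^sup>2) \<le> real n * L\<^sup>2" by blast
  let ?S = "\<lambda>x. \<Sum>i=1..n. g (t i) x - f x"
  have gt: "(\<lambda>x. g (t i) x) \<in> borel_measurable M" if "i \<in> {1..n}" for i
    using measurable_Pair1[OF gm, of "t i"] t(1) that by simp
  have Sm: "?S \<in> borel_measurable M"
    using gt fm by (intro borel_measurable_sum borel_measurable_diff) auto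
  \<comment> \<open>A crude uniform bound, wanted only for the integrability in the greedy
    step.\<close>
  have Sb: "\<bar>?S x\<bar> \<le> real n * (2 * L)" for x
  proof -
    have "\<bar>?S x\<bar> \<le> (\<Sum>i=1..n. \<bar>g (t i) x - f x\<bar>)" by (rule sum_abs)
    also have "\<dots> \<le> (\<Sum>i=1..n. 2 * L)"
    proof (rule sum_mono)
      show "\<bar>g (t i) x - f x\<bar> \<le> 2 * L" for i using gb[of "t i" x] fb[of x] by linarith
    qed
    finally show ?thesis by simp
  qed
  obtain s where s: "s \<in> space N"
    "(LINT x|M. (?S x + (g s x - f x))\<^sup>2) \<le> (LINT x|M. (?S x)\<^sup>2) + L\<^sup>2"
    using greedy_step[OF M N gm fm Sm gb Sb gf] by blast
  let ?t = "t(Suc n := s)"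
  have "(\<Sum>i=1..Suc n. g (?t i) x - f x) = ?S x + (g s x - f x)" for x
    by (simp add: sum.cong[of "{1..n}" "{1..n}" "\<lambda>i. g (?t i) x - f x" "\<lambda>i. g (t i) x - f x"])
  hence "(LINT x|M. (\<Sum>i=1..Suc n. g (?t i) x - f x)\<^sup>2) \<le> real (Suc n) * L\<^sup>2"
    using s(2) t(2) by (simp add: algebra_simps)
  moreover have "\<forall>i\<in>{1..Suc n}. ?t i \<in> space N" using t(1) s(1) by auto
  ultimately show ?case by blast
qed

section \<open>Approximation by the network\<close>

lemma Re_sgn_mult_cis: 
  assumes "z \<noteq> 0"
  shows "Re (sgn z * cis r) = cos (Arg z + r)"
  by (simp add: cis_Arg[OF assms, symmetric] cis_mult)

text \<open>The frequency is \<open>(2 * pi) *\<^sub>R \<xi>\<close>, the phase is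
  \<open>Arg z\<close>, and \<open>\<gamma> = arccos (L / R)\<close> lowers the amplitude from
  \<open>R\<close> to \<open>L\<close>. For \<open>z = 0\<close> the target vanishes, and
  \<open>\<gamma> = pi / 2\<close> silences the neuron.\<close>

lemma scaled_cosine_parameters:
  fixes \<xi> :: "real ^ 'd"
  assumes R: "R > 0" and L: "0 \<le> L" "L \<le> R"
  shows "\<exists>p \<in> UNIV \<times> UNIV \<times> {0..2 * pi}. \<forall>x. R * (case p of (a, b, \<gamma>) \<Rightarrow> cos \<gamma> * cos (b + inner a x))
      = L * Re (sgn z * cis (2 * pi * inner x \<xi>))"
proof (cases "z = 0")
  case True
  have "(0, 0, pi / 2) \<in> (UNIV :: (real ^ 'd) set) \<times> UNIV \<times> {0..2 * pi}" by simp
  thus ?thesis using True by (intro bexI[of _ "(0, 0, pi / 2)"]) auto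
next
  case False
  have LR: "-1 \<le> L / R" "L / R \<le> 1" using R L by (auto simp: field_simps)
  have "arccos (L / R) \<in> {0..2 * pi}" using arccos_bounded[OF LR] by auto
  moreover have "R * (cos (arccos (L / R)) * cos (Arg z + inner ((2 * pi) *\<^sub>R \<xi>) x))
      = L * Re (sgn z * cis (2 * pi * inner x \<xi>))" for x
    unfolding Re_sgn_mult_cis[OF False] using LR R by (simp add: inner_commute)
  ultimately show ?thesis
    by (intro bexI[of _ "((2 * pi) *\<^sub>R \<xi>, Arg z, arccos (L / R))"]) auto
qed

text \<open>
  The factor \<open>sgn\<close> avoids a choice of the argument and is 0 where the transform vanishes; the network
  realises that value with \<open>\<gamma> = \<pi> / 2\<close>.
\<close>

definition neuron :: "(real ^ 'd \<Rightarrow> real) \<Rightarrow> real ^ 'd \<Rightarrow> real ^ 'd \<Rightarrow> real" where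
  "neuron f \<xi> x = L1_norm (fourier f) * Re (sgn (fourier f \<xi>) * cis (2 * pi * inner x \<xi>))"

text \<open>Division by zero gives 0, so this is the null measure when the transform has norm 0; the
  facts about it below therefore exclude that case.\<close>

definition frequency_measure ::
  "(real ^ 'd \<Rightarrow> real) \<Rightarrow> (real ^ 'd) measure" where
  "frequency_measure f = density lborel (\<lambda>\<xi>. ennreal (norm (fourier f \<xi>) / L1_norm (fourier f)))"

section \<open>Random neurons attached to a fixed function\<close>

context
  fixes f :: "real ^ 'd \<Rightarrow> real"
  assumes cont: "continuous_on UNIV f" and int: "integrable lborel f"
    and Fint: "integrable lborel (fourier f)"
begin

lemma fourier_inversion_cis:
  "integrable lborel (\<lambda>\<xi>. fourier f \<xi> * cis (2 * pi * inner x \<xi>))"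
  "(LINT \<xi>|lborel. fourier f \<xi> * cis (2 * pi * inner x \<xi>)) = complex_of_real (f x)"
proof -
  have [measurable]: "fourier f \<in> borel_measurable borel"
    using borel_measurable_integrable[OF Fint] by simp
  show "integrable lborel (\<lambda>\<xi>. fourier f \<xi> * cis (2 * pi * inner x \<xi>))"
    by (rule Bochner_Integration.integrable_bound[OF Fint]) (auto simp: norm_mult cis_conv_exp)
  show "(LINT \<xi>|lborel. fourier f \<xi> * cis (2 * pi * inner x \<xi>)) = complex_of_real (f x)"
    using fourier_inversion[OF cont int Fint, of x] by (simp add: cis_conv_exp mult_ac)
qed

text \<open>Inversion and the triangle inequality, the phase having modulus 1.\<close>

lemma abs_le_L1_norm_fourier: "\<bar>f x\<bar> \<le> L1_norm (fourier f)"
proof -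
  have "\<bar>f x\<bar> = norm (LINT \<xi>|lborel. fourier f \<xi> * cis (2 * pi * inner x \<xi>))"
    unfolding fourier_inversion_cis by simp
  also have "\<dots> \<le> (LINT \<xi>|lborel. norm (fourier f \<xi> * cis (2 * pi * inner x \<xi>)))"
    by (rule integral_norm_bound)
  finally show ?thesis by (simp add: norm_mult L1_norm_def)
qed

lemma abs_neuron_le: "\<bar>neuron f \<xi> x\<bar> \<le> L1_norm (fourier f)"
proof -
  have "\<bar>Re (sgn (fourier f \<xi>) * cis (2 * pi * inner x \<xi>))\<bar>
      \<le> norm (sgn (fourier f \<xi>) * cis (2 * pi * inner x \<xi>))"
    by (rule abs_Re_le_cmod)
  also have "\<dots> \<le> 1" by (simp add: norm_mult norm_sgn)
  finally show ?thesis
    by (simp add: neuron_def abs_mult L1_norm_def mult_left_le)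
qed

lemma borel_measurable_neuron:
  "(\<lambda>p. neuron f (snd p) (fst p)) \<in> borel_measurable (borel \<Otimes>\<^sub>M borel)"
  "neuron f \<xi> \<in> borel_measurable borel" "(\<lambda>\<xi>. neuron f \<xi> x) \<in> borel_measurable borel"
proof -
  have [measurable]: "fourier f \<in> borel_measurable borel"
    using borel_measurable_integrable[OF Fint] by simp
  show "(\<lambda>p. neuron f (snd p) (fst p)) \<in> borel_measurable (borel \<Otimes>\<^sub>M borel)"
    unfolding neuron_def cis_conv_exp sgn_div_norm by measurable
  show "neuron f \<xi> \<in> borel_measurable borel" "(\<lambda>\<xi>. neuron f \<xi> x) \<in> borel_measurable borel"
    unfolding neuron_def cis_conv_exp sgn_div_norm by measurable
qed

lemma prob_space_frequency_measure:
  assumes "L1_norm (fourier f) \<noteq> 0"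
  shows "prob_space (frequency_measure f)"
proof
  let ?L = "L1_norm (fourier f)"
  have L0: "0 \<le> ?L" by (simp add: L1_norm_def)
  have [measurable]: "fourier f \<in> borel_measurable borel"
    using borel_measurable_integrable[OF Fint] by simp
  have "emeasure (frequency_measure f) (space (frequency_measure f))
      = (\<integral>\<^sup>+\<xi>. ennreal (norm (fourier f \<xi>) / ?L) \<partial>lborel)"
    unfolding frequency_measure_def by (simp add: emeasure_density)
  also have "\<dots> = ennreal (LINT \<xi>|lborel. norm (fourier f \<xi>) / ?L)"
    using Fint L0 by (intro nn_integral_eq_integral) auto
  also have "(LINT \<xi>|lborel. norm (fourier f \<xi>) / ?L) = 1"
    using assms by (simp add: L1_norm_def)
  finally show "emeasure (frequency_measure f) (space (frequency_measure f)) = 1" by simp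
qed

text \<open>The density supplies the modulus of the transform and the neuron its \<open>sgn\<close>;
  their product is the transform itself, so the mean is the real part of the inversion
  integral.\<close>

lemma expectation_neuron:
  assumes "L1_norm (fourier f) \<noteq> 0"
  shows "(LINT \<xi>|frequency_measure f. neuron f \<xi> x) = f x"
proof -
  let ?L = "L1_norm (fourier f)"
  have L0: "0 \<le> ?L" by (simp add: L1_norm_def)
  have [measurable]: "fourier f \<in> borel_measurable borel"
    using borel_measurable_integrable[OF Fint] by simp
  have "(LINT \<xi>|frequency_measure f. neuron f \<xi> x)
      = (LINT \<xi>|lborel. (norm (fourier f \<xi>) / ?L) *\<^sub>R neuron f \<xi> x)"
    unfolding frequency_measure_def using L0 borel_measurable_neuron(3)
    by (intro integral_density) auto
  also have "\<dots> = (LINT \<xi>|lborel. Re (fourier f \<xi> * cis (2 * pi * inner x \<xi>)))"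
  proof (intro Bochner_Integration.integral_cong refl)
    fix \<xi>
    have "complex_of_real (norm (fourier f \<xi>)) * sgn (fourier f \<xi>) = fourier f \<xi>"
      by (cases "fourier f \<xi> = 0") (simp_all add: sgn_eq)
    hence "Re (fourier f \<xi> * cis (2 * pi * inner x \<xi>))
       = Re (complex_of_real (norm (fourier f \<xi>)) * (sgn (fourier f \<xi>) * cis (2 * pi * inner x \<xi>)))"
      by (simp only: mult.assoc[symmetric])
    also have "\<dots> = norm (fourier f \<xi>) * Re (sgn (fourier f \<xi>) * cis (2 * pi * inner x \<xi>))"
      by (simp only: scaleR_conv_of_real[symmetric] scaleR_complex.simps)
    finally show "(norm (fourier f \<xi>) / ?L) *\<^sub>R neuron f \<xi> x = Re (fourier f \<xi> * cis (2 * pi * inner x \<xi>))"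
      using assms by (simp add: neuron_def)
  qed
  also have "\<dots> = Re (LINT \<xi>|lborel. fourier f \<xi> * cis (2 * pi * inner x \<xi>))"
    by (rule integral_Re[OF fourier_inversion_cis(1)])
  finally show ?thesis by (simp add: fourier_inversion_cis)
qed

lemma neuron_approximation:
  assumes M: "prob_space M" and sets: "sets M = sets borel"
  shows "\<exists>t :: nat \<Rightarrow> real ^ 'd.
    (LINT x|M. (\<Sum>i=1..n. neuron f (t i) x - f x)\<^sup>2) \<le> real n * (L1_norm (fourier f))\<^sup>2"
proof (cases "L1_norm (fourier f) = 0")
  case True
  \<comment> \<open>Without a sampling law, the claim holds for any choice of frequencies, because
    target and neurons vanish identically.\<close>
  hence "f x = 0" "neuron f \<xi> x = 0" for x \<xi>
    using abs_le_L1_norm_fourier[of x] by (auto simp: neuron_def)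
  thus ?thesis using True by simp
next
  case False
  have s: "sets (M \<Otimes>\<^sub>M frequency_measure f) = sets (borel \<Otimes>\<^sub>M borel)"
    by (intro sets_pair_measure_cong sets) (simp add: frequency_measure_def)
  have "(\<lambda>(x, \<xi>). neuron f \<xi> x) \<in> borel_measurable (M \<Otimes>\<^sub>M frequency_measure f)"
    using borel_measurable_neuron(1) unfolding measurable_cong_sets[OF s refl] case_prod_unfold .
  moreover have "f \<in> borel_measurable M"
    using borel_measurable_continuous_onI[OF cont] unfolding measurable_cong_sets[OF sets refl] .
  ultimately show ?thesis
    using maurey_sampling[OF M prob_space_frequency_measure[OF False], of "neuron f" f "L1_norm (fourier f)" n]
      abs_neuron_le abs_le_L1_norm_fourier expectation_neuron[OF False]
    by blast
qed

text \<open>A bounded Borel function on a probability space. This keeps the final error bound from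
  holding merely through the default value 0 of the integral.\<close>

lemma integrable_neuron_error:
  assumes M: "prob_space M" and sets: "sets M = sets borel" and n: "n \<ge> 1"
  shows "integrable M (\<lambda>x. \<bar>f x - (\<Sum>i=1..n. neuron f (t i) x) / real n\<bar>\<^sup>2)"
proof -
  let ?q = "\<lambda>x. (\<Sum>i=1..n. neuron f (t i) x) / real n"
  let ?L = "L1_norm (fourier f)"
  have fm: "f \<in> borel_measurable borel" by (rule borel_measurable_continuous_onI[OF cont])
  have "(\<lambda>x. \<bar>f x - ?q x\<bar>\<^sup>2) \<in> borel_measurable borel"
    by (intro borel_measurable_power borel_measurable_abs borel_measurable_diff fm
        borel_measurable_divide borel_measurable_sum borel_measurable_neuron(2) borel_measurable_const)
  hence meas: "(\<lambda>x. \<bar>f x - ?q x\<bar>\<^sup>2) \<in> borel_measurable M"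
    unfolding measurable_cong_sets[OF sets refl] .
  have "norm (\<bar>f x - ?q x\<bar>\<^sup>2) \<le> (2 * ?L)\<^sup>2" for x
  proof -
    have "\<bar>\<Sum>i=1..n. neuron f (t i) x\<bar> \<le> (\<Sum>i=1..n. \<bar>neuron f (t i) x\<bar>)" by (rule sum_abs)
    also have "\<dots> \<le> (\<Sum>i=1..n. ?L)" by (intro sum_mono abs_neuron_le)
    finally have "\<bar>?q x\<bar> \<le> ?L" using n by (simp add: field_simps)
    hence "\<bar>f x - ?q x\<bar> \<le> 2 * ?L" using abs_le_L1_norm_fourier[of x] by linarith
    hence "\<bar>f x - ?q x\<bar>\<^sup>2 \<le> (2 * ?L)\<^sup>2" by (intro power_mono) auto
    thus ?thesis by simp
  qed
  thus ?thesis
    using finite_measure.integrable_const_bound[OF prob_space.finite_measure[OF M] _ meas] by blast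
qed

end

lemma qnn_eq_neuron_mean:
  fixes f :: "real ^ 'd::{finite,linorder} \<Rightarrow> real"
  assumes R: "R > 0" and LR: "L1_norm (fourier f) \<le> R" and n: "n \<ge> 1" and V: "state_prep n V"
  shows "\<exists>\<theta> \<in> Theta n. \<forall>x. qnn R n V \<theta> x = (\<Sum>i=1..n. neuron f (t i) x) / real n"
proof -
  have L0: "0 \<le> L1_norm (fourier f)" by (simp add: L1_norm_def)
  have "\<exists>p. p \<in> UNIV \<times> UNIV \<times> {0..2 * pi} \<and>
      (\<forall>x. R * (case p of (a, b, \<gamma>) \<Rightarrow> cos \<gamma> * cos (b + inner a x)) = neuron f (t i) x)" for i
    using scaled_cosine_parameters[OF R L0 LR, of "fourier f (t i)" "t i"] unfolding neuron_def by blast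
  then obtain p where p: "\<And>i. p i \<in> UNIV \<times> UNIV \<times> {0..2 * pi}"
    "\<And>i x. R * (case p i of (a, b, \<gamma>) \<Rightarrow> cos \<gamma> * cos (b + inner a x)) = neuron f (t i) x" by metis
  \<comment> \<open>Tuples in \<open>Theta n\<close> are extensional, so the choice function is cut
    down to the index set.\<close>
  define \<theta> where "\<theta> = restrict p {1..n}"
  have "\<theta> \<in> Theta n" unfolding Theta_def \<theta>_def using p(1) by auto
  moreover have "qnn R n V \<theta> x = (\<Sum>i=1..n. neuron f (t i) x) / real n" for x
  proof -
    have "(\<Sum>i=1..n. neuron f (t i) x)
        = (\<Sum>i=1..n. R * (case \<theta> i of (a, b, \<gamma>) \<Rightarrow> cos \<gamma> * cos (b + inner a x)))"
      by (intro sum.cong refl) (simp add: \<theta>_def p(2))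
    thus ?thesis unfolding qnn_eq_cosine_sum[OF V n] by (simp add: sum_distrib_left[symmetric])
  qed
  ultimately show ?thesis by blast
qed

theorem mainTheorem1:
  fixes \<mu> :: "(real ^ 'd::{finite,linorder}) measure"
    and R :: real
    and f :: "real ^ 'd::{finite,linorder} \<Rightarrow> real"
    and n :: nat
    and V :: "complex mat"
  assumes "prob_space \<mu>" and "sets \<mu> = sets borel"
    and "R > 0"
    and "f \<in> F_class R"
    and "n \<ge> 1"
    and "state_prep n V"
  shows "\<exists>\<theta> \<in> Theta n.
           integrable \<mu> (\<lambda>x. \<bar>f x - qnn R n V \<theta> x\<bar>\<^sup>2) \<and>
           sqrt (LINT x|\<mu>. \<bar>f x - qnn R n V \<theta> x\<bar>\<^sup>2) \<le> L1_norm (fourier f) / sqrt (real n)"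
proof -
  let ?L = "L1_norm (fourier f)"
  have cont: "continuous_on UNIV f" and int: "integrable lborel f"
    and Fint: "integrable lborel (fourier f)" and LR: "?L \<le> R"
    using assms(4) by (auto simp: F_class_def)
  have L0: "0 \<le> ?L" by (simp add: L1_norm_def)
  obtain t where t: "(LINT x|\<mu>. (\<Sum>i=1..n. neuron f (t i) x - f x)\<^sup>2) \<le> real n * ?L\<^sup>2"
    using neuron_approximation[OF cont int Fint assms(1,2)] by blast
  obtain \<theta> where \<theta>: "\<theta> \<in> Theta n" and qnn: "\<And>x. qnn R n V \<theta> x = (\<Sum>i=1..n. neuron f (t i) x) / real n"
    using qnn_eq_neuron_mean[OF assms(3) LR assms(5,6)] by blast
  \<comment> \<open>The sum contains \<open>n\<close> copies of \<open>f x\<close>, so the error of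
    the mean is the summed deviation over \<open>n\<close>; its square brings the factor that turns
    \<open>n * ?L\<^sup>2\<close> into \<open>?L\<^sup>2 / n\<close>.\<close>
  have err: "\<bar>f x - qnn R n V \<theta> x\<bar>\<^sup>2 = (\<Sum>i=1..n. neuron f (t i) x - f x)\<^sup>2 / (real n)\<^sup>2" for x
  proof -
    have "f x - qnn R n V \<theta> x = - (\<Sum>i=1..n. neuron f (t i) x - f x) / real n"
      using assms(5) by (simp add: qnn sum_subtractf field_simps)
    thus ?thesis by (simp add: power_divide)
  qed
  have "(LINT x|\<mu>. \<bar>f x - qnn R n V \<theta> x\<bar>\<^sup>2)
      = (LINT x|\<mu>. (\<Sum>i=1..n. neuron f (t i) x - f x)\<^sup>2) / (real n)\<^sup>2"
    unfolding err by simp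
  also have "\<dots> \<le> real n * ?L\<^sup>2 / (real n)\<^sup>2" using t by (rule divide_right_mono) simp
  also have "\<dots> = (?L / sqrt (real n))\<^sup>2"
    using assms(5) by (simp add: power_divide power2_eq_square)
  finally have "sqrt (LINT x|\<mu>. \<bar>f x - qnn R n V \<theta> x\<bar>\<^sup>2) \<le> ?L / sqrt (real n)"
    using L0 by (intro real_le_lsqrt) auto
  moreover have "integrable \<mu> (\<lambda>x. \<bar>f x - qnn R n V \<theta> x\<bar>\<^sup>2)"
    unfolding qnn by (rule integrable_neuron_error[OF cont int Fint assms(1,2,5)])
  ultimately show ?thesis using \<theta> by blast
qed

end
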